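(* Let $(G_k)_{k\ge1}$, $G_k=(L_k\cup R_k,E_k)$, be a sequence of random bipartite (multi)graphs with totally ordered left vertex sets $L_k$ and right vertex sets $R_k$, such that $|L_k|\to\infty$, $|R_k|\to\infty$ and $|E_k|\to\infty$. If $(G_k)$ is asymptotically block-free of order $4$, then $(G_k)$ is asymptotically block-free of order $s$ for every integer $s\ge 2$.
   Context: For a bipartite (multi)graph $G=(L\cup R,E)$ with ordered left vertices $L=\{u_1,\dots,u_n\}$ and ordered right vertices $R=\{v_1,\dots,v_m\}$ (an edge is a pair $(u_i,v_j)$; in a multigraph several edges may have the same endpoints), and an integer $s\ge2$, sample $s$ distinct edges $(u_{i(1)},v_{j(1)}),\dots,(u_{i(s)},v_{j(s)})$ and list them sorted by left endpoint, so that $i(1)\le i(2)\le\cdots\le i(s)$. A permutation $\sigma\in\mathfrak S_s$ induced by the sample is one chosen uniformly at random among those permutations satisfying $j(\sigma(1))\le j(\sigma(2))\le\cdots\le j(\sigma(s))$ (if there are no ties this $\sigma$ is unique). Here $\mathfrak S_s$ denotes the set of permutations of $\{1,\dots,s\}$. A sequence of random bipartite (multi)graphs $G_k=(L_k\cup R_k,E_k)$ with $|L_k|,|R_k|,|E_k|\to\infty$ is called asymptotically block-free of order $s$ if the distribution of the permutation induced by a uniformly random sample of $s$ distinct edges of $G_k$ converges, as $k\to\infty$, to the uniform distribution on $\mathfrak S_s$. *)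

theory Defs
  imports "HOL-Probability.Probability" "HOL-Combinatorics.Permutations"
begin

text \<open>
  A finite bipartite multigraph with left vertices \<open>u\<^sub>1, \<dots>, u\<^sub>n\<close> and right vertices
  \<open>v\<^sub>1, \<dots>, v\<^sub>m\<close>, represented by their indices. The edge \<open>(u\<^sub>i, v\<^sub>j)\<close> is the pair
  \<open>(i, j)\<close>. Positions in the edge list serve as identities of the edges, so that parallel edges
  are distinct; the order of the list has no other significance.
\<close>

datatype bip_multigraph =
  Bip_Multigraph (left_size: nat) (right_size: nat) (edge_list: "(nat \<times> nat) list")

definition wf_bip_multigraph :: "bip_multigraph \<Rightarrow> bool" where
  "wf_bip_multigraph g \<longleftrightarrow> set (edge_list g) \<subseteq> {1..left_size g} \<times> {1..right_size g}"

definition edge_set :: "bip_multigraph \<Rightarrow> nat set" where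
  "edge_set g = {..<length (edge_list g)}"

definition left_end :: "bip_multigraph \<Rightarrow> nat \<Rightarrow> nat" where
  "left_end g e = fst (edge_list g ! e)"

definition right_end :: "bip_multigraph \<Rightarrow> nat \<Rightarrow> nat" where
  "right_end g e = snd (edge_list g ! e)"

definition edge_samples :: "nat \<Rightarrow> bip_multigraph \<Rightarrow> nat set set" where
  "edge_samples s g = {A. A \<subseteq> edge_set g \<and> card A = s}"

text \<open>The listings \<open>e 1, \<dots>, e s\<close> of a sample that are sorted by left endpoint.\<close>

definition left_sorted_listings :: "nat \<Rightarrow> bip_multigraph \<Rightarrow> nat set \<Rightarrow> (nat \<Rightarrow> nat) set" where
  "left_sorted_listings s g A =
     {e \<in> extensional {1..s}. bij_betw e {1..s} A \<and> mono_on {1..s} (\<lambda>t. left_end g (e t))}"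

definition inducible_perms :: "nat \<Rightarrow> bip_multigraph \<Rightarrow> (nat \<Rightarrow> nat) \<Rightarrow> (nat \<Rightarrow> nat) set" where
  "inducible_perms s g e =
     {\<sigma>. \<sigma> permutes {1..s} \<and> mono_on {1..s} (\<lambda>t. right_end g (e (\<sigma> t)))}"

text \<open>
  The distribution of the permutation induced by a uniformly random sample of \<open>s\<close> distinct edges
  of a fixed multigraph. Ties between left endpoints and ties between right endpoints are both
  broken uniformly at random. If there are fewer than \<open>s\<close> edges, the value is an unspecified
  distribution; this is irrelevant for limits in which the number of edges tends to infinity.
\<close>

definition induced_perm :: "nat \<Rightarrow> bip_multigraph \<Rightarrow> (nat \<Rightarrow> nat) pmf" where
  "induced_perm s g = do {
     A \<leftarrow> pmf_of_set (edge_samples s g);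
     e \<leftarrow> pmf_of_set (left_sorted_listings s g A);
     pmf_of_set (inducible_perms s g e)
   }"

text \<open>
  A random multigraph is given by its distribution: as there are only countably many multigraphs,
  every distribution of a random multigraph is a \<open>pmf\<close>.
\<close>

definition tends_to_infinity_in_prob ::
    "(nat \<Rightarrow> 'a pmf) \<Rightarrow> ('a \<Rightarrow> nat) \<Rightarrow> bool" where
  "tends_to_infinity_in_prob G f \<longleftrightarrow>
     (\<forall>N. (\<lambda>k. measure_pmf.prob (G k) {g. N \<le> f g}) \<longlonglongrightarrow> 1)"

definition asymp_block_free :: "nat \<Rightarrow> (nat \<Rightarrow> bip_multigraph pmf) \<Rightarrow> bool" where
  "asymp_block_free s G \<longleftrightarrow>
     (\<forall>\<sigma>. \<sigma> permutes {1..s} \<longrightarrow>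
        (\<lambda>k. pmf (bind_pmf (G k) (induced_perm s)) \<sigma>)
          \<longlonglongrightarrow> pmf (pmf_of_set {\<tau>. \<tau> permutes {1..s}}) \<sigma>)"

end

theory Submission
  imports Defs
begin

text \<open>
  The argument is that of Kral and Pikhurko, kept linear in the pattern densities so that it
  survives taking expectations. Breaking all ties at random turns a multigraph with \<open>n\<close> edges into
  \<open>n\<close> points \<open>(\<alpha> h, \<beta> h)\<close> with distinct coordinates. Write \<open>F (x, y)\<close> for the fraction of points
  below and to the left of \<open>(x, y)\<close>, with coordinates scaled to \<open>[0, 1]\<close>, \<open>\<mu>\<close> for the uniform measure
  on the points and \<open>\<lambda>\<close> for the Lebesgue measure. Up to \<open>O(1/n)\<close>, Fubini's theorem gives
  \<open>\<integral> F x y d\<lambda> = (1/3 + \<integral> x\<^sup>2 y\<^sup>2 d\<mu>) / 4\<close>, and hence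
  \<open>\<integral> (F - x y)\<^sup>2 d\<lambda> + \<integral> (F - x y)\<^sup>2 d\<mu> / 2 = \<integral> F\<^sup>2 d\<lambda> + \<integral> F\<^sup>2 d\<mu> / 2 - \<integral> F x y d\<mu> - 1/18\<close>.
  The three integrals on the right are probabilities of order events for four random points, so the
  right-hand side is a linear combination of the deviations of the \<open>4\<close>-point densities from \<open>1/24\<close>.
  As \<open>F\<close> is Lipschitz, smallness of the first integral makes \<open>F - x y\<close> uniformly small, and then
  \<open>s\<close> sampled points can be replaced one at a time by independent uniform points of the square.
\<close>

section \<open>Sorting permutations and pattern counts\<close>

text \<open>The obstacle is \<integral> x^2 y^2 d\<mu>: it is an order event for five points (the
  point itself, two more for x^2 and two for y^2), out of reach of four-point densities. Fubini
  makes it enter the first square with coefficient -2 * (1/4) = -1/2, and the second square carries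
  the weight 1/2 precisely to cancel it. Every remaining integral needs at most four points; for
  \<integral> F^2 d\<lambda> the uniform point borrows its abscissa from one sampled point and its
  ordinate from another. The constant is 1/9 - 2 * (1/12) = -1/18. For independent uniform
  coordinates each of the three integrals is 1/9, and the right-hand side vanishes. The hypothesis
  controls only averages over \<open>G k\<close>, never a single graph, so every intermediate bound
  has to be affine in the densities. Since the left-hand side is nonnegative for each graph, a small
  expectation is enough.\<close>

lemma rank_of_sorted:
  fixes v :: "nat \<Rightarrow> nat"
  assumes "\<pi> permutes {1..s}" and "strict_mono_on {1..s} (\<lambda>t. v (\<pi> t))" and "t \<in> {1..s}"
  shows "card {j \<in> {1..s}. v j \<le> v (\<pi> t)} = t"
proof -
  have less: "v (\<pi> t) < v (\<pi> u)" if "t \<in> {1..s}" "u \<in> {1..s}" "t < u" for t u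
    using assms(2) that unfolding monotone_on_def by blast
  have "{j \<in> {1..s}. v j \<le> v (\<pi> t)} = \<pi> ` {1..t}"
  proof (intro set_eqI iffI)
    fix j assume j: "j \<in> {j \<in> {1..s}. v j \<le> v (\<pi> t)}"
    then have "j \<in> \<pi> ` {1..s}" unfolding permutes_image[OF assms(1)] by simp
    then obtain u where u: "u \<in> {1..s}" "j = \<pi> u" by blast
    have "u \<le> t"
    proof (rule ccontr)
      assume "\<not> u \<le> t"
      then have "v (\<pi> t) < v (\<pi> u)"
        using less[OF assms(3) u(1)] by simp
      then show False using j u by simp
    qed
    then show "j \<in> \<pi> ` {1..t}" using u by auto
  next
    fix j assume "j \<in> \<pi> ` {1..t}"
    then obtain u where u: "u \<in> {1..t}" "j = \<pi> u" by auto
    then have us: "u \<in> {1..s}" using assms(3) by auto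
    have "v (\<pi> u) \<le> v (\<pi> t)"
      using less[OF us assms(3)] u by (cases "u = t") auto
    moreover have "j \<in> {1..s}" using u(2) us permutes_in_image[OF assms(1), of u] by simp
    ultimately show "j \<in> {j \<in> {1..s}. v j \<le> v (\<pi> t)}" using u(2) by simp
  qed
  then have "card {j \<in> {1..s}. v j \<le> v (\<pi> t)} = card (\<pi> ` {1..t})" by simp
  also have "\<dots> = t"
    using card_image[OF permutes_inj_on[OF assms(1)], of "{1..t}"] by simp
  finally show ?thesis .
qed

text \<open>By \<open>rank_of_sorted\<close>, a permutation sorting \<open>v\<close> is the inverse
  of the rank map of \<open>v\<close>, so two of them agree.\<close>

lemma sorting_perm_unique:
  fixes v :: "nat \<Rightarrow> nat"
  assumes "\<pi> permutes {1..s}" "strict_mono_on {1..s} (\<lambda>t. v (\<pi> t))"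
    and "\<rho> permutes {1..s}" "strict_mono_on {1..s} (\<lambda>t. v (\<rho> t))"
  shows "\<pi> = \<rho>"
proof
  fix t
  show "\<pi> t = \<rho> t"
  proof (cases "t \<in> {1..s}")
    case True
    then obtain u where u: "u \<in> {1..s}" "\<pi> t = \<rho> u"
      using permutes_image[OF assms(3)] permutes_in_image[OF assms(1), of t]
      by (metis imageE)
    have "t = u"
      using rank_of_sorted[OF assms(1,2) True] rank_of_sorted[OF assms(3,4) u(1)] u by simp
    then show ?thesis using u by simp
  next
    case False
    then show ?thesis using assms(1,3) by (simp add: permutes_not_in)
  qed
qed

lemma sorting_perm_exists:
  fixes v :: "nat \<Rightarrow> nat"
  assumes "inj_on v {1..s}"
  obtains \<pi> where "\<pi> permutes {1..s}" "strict_mono_on {1..s} (\<lambda>t. v (\<pi> t))"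
proof -
  \<comment> \<open>The rank map, extended by the identity because \<open>permutes\<close> demands
    fixed points outside \<open>{1..s}\<close>; its inverse lists the indices by increasing
    \<open>v\<close>.\<close>
  define r where "r i = (if i \<in> {1..s} then card {j \<in> {1..s}. v j \<le> v i} else i)" for i
  have r_less: "r i < r j" if "i \<in> {1..s}" "j \<in> {1..s}" "v i < v j" for i j
  proof -
    have "{k \<in> {1..s}. v k \<le> v i} \<subset> {k \<in> {1..s}. v k \<le> v j}"
    proof (rule psubsetI)
      have "j \<in> {k \<in> {1..s}. v k \<le> v j}" "j \<notin> {k \<in> {1..s}. v k \<le> v i}" using that by auto
      then show "{k \<in> {1..s}. v k \<le> v i} \<noteq> {k \<in> {1..s}. v k \<le> v j}" by metis
    qed (use that in auto)
    then show ?thesis using that unfolding r_def by (simp add: psubset_card_mono)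
  qed
  have r_in: "r i \<in> {1..s}" if "i \<in> {1..s}" for i
  proof -
    have "card {j \<in> {1..s}. v j \<le> v i} \<le> card {1..s}" by (intro card_mono) auto
    moreover have "card {j \<in> {1..s}. v j \<le> v i} > 0"
      using that by (subst card_gt_0_iff) auto
    ultimately show ?thesis using that unfolding r_def by auto
  qed
  have inj: "inj_on r {1..s}"
  proof (rule inj_onI)
    fix i j assume ij: "i \<in> {1..s}" "j \<in> {1..s}" "r i = r j"
    have "v i = v j" using r_less[of i j] r_less[of j i] ij by (metis less_irrefl nat_neq_iff)
    then show "i = j" using assms ij by (auto dest: inj_onD)
  qed
  have "r ` {1..s} = {1..s}"
    using inj r_in by (intro card_subset_eq) (auto simp: card_image)
  then have "r permutes {1..s}"
    using inj by (intro bij_imp_permutes) (auto simp: bij_betw_def r_def)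
  then have perm: "inv r permutes {1..s}" by (rule permutes_inv)
  have "strict_mono_on {1..s} (\<lambda>t. v (inv r t))"
  proof (rule strict_mono_onI)
    fix t u assume tu: "t \<in> {1..s}" "u \<in> {1..s}" "t < u"
    have *: "inv r t \<in> {1..s}" "inv r u \<in> {1..s}"
      using tu permutes_in_image[OF perm] by auto
    have r: "r (inv r t) = t" "r (inv r u) = u"
      using \<open>r permutes {1..s}\<close> by (auto simp: permutes_inverses)
    show "v (inv r t) < v (inv r u)"
    proof (rule ccontr)
      assume "\<not> ?thesis"
      then consider "v (inv r u) < v (inv r t)" | "v (inv r u) = v (inv r t)" by linarith
      then show False
      proof cases
        case 1
        then show ?thesis using r_less[OF *(2,1)] r tu by simp
      next
        case 2
        then have "inv r u = inv r t" using assms * by (auto dest: inj_onD)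
        then show ?thesis using r tu by simp
      qed
    qed
  qed
  then show ?thesis using perm that by blast
qed

lemma comp_permutes_PiE:
  assumes "\<pi> permutes I" "h \<in> I \<rightarrow>\<^sub>E A"
  shows "h \<circ> \<pi> \<in> I \<rightarrow>\<^sub>E A"
  using assms permutes_in_image[OF assms(1)] permutes_not_in[OF assms(1)]
  by (auto simp: PiE_iff extensional_def)

lemma bij_betw_comp_permutes_PiE:
  assumes "\<pi> permutes I"
  shows "bij_betw (\<lambda>h. h \<circ> \<pi>) (I \<rightarrow>\<^sub>E A) (I \<rightarrow>\<^sub>E A)"
proof (rule bij_betw_byWitness[where f' = "\<lambda>h. h \<circ> inv \<pi>"])
  show "\<forall>h\<in>I \<rightarrow>\<^sub>E A. h \<circ> \<pi> \<circ> inv \<pi> = h"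
    using permutes_inv_o(1)[OF assms] by (auto simp: comp_assoc)
  show "\<forall>h\<in>I \<rightarrow>\<^sub>E A. h \<circ> inv \<pi> \<circ> \<pi> = h"
    using permutes_inv_o(2)[OF assms] by (auto simp: comp_assoc)
  show "(\<lambda>h. h \<circ> \<pi>) ` (I \<rightarrow>\<^sub>E A) \<subseteq> I \<rightarrow>\<^sub>E A"
    using comp_permutes_PiE[OF assms] by (intro image_subsetI)
  show "(\<lambda>h. h \<circ> inv \<pi>) ` (I \<rightarrow>\<^sub>E A) \<subseteq> I \<rightarrow>\<^sub>E A"
    using comp_permutes_PiE[OF permutes_inv[OF assms]] by (intro image_subsetI)
qed

lemma card_comp_permutes_PiE:
  assumes "\<pi> permutes I"
  shows "card {h \<in> I \<rightarrow>\<^sub>E A. P (h \<circ> \<pi>)} = card {h \<in> I \<rightarrow>\<^sub>E A. P h}"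
proof -
  note bij = bij_betw_comp_permutes_PiE[OF assms, of A]
  have "inj_on (\<lambda>h. h \<circ> \<pi>) {h \<in> I \<rightarrow>\<^sub>E A. P (h \<circ> \<pi>)}"
    using bij unfolding bij_betw_def by (auto elim: inj_on_subset)
  moreover have "(\<lambda>h. h \<circ> \<pi>) ` {h \<in> I \<rightarrow>\<^sub>E A. P (h \<circ> \<pi>)} = {h \<in> I \<rightarrow>\<^sub>E A. P h}"
  proof (intro set_eqI iffI)
    fix h assume h: "h \<in> {h \<in> I \<rightarrow>\<^sub>E A. P h}"
    then have "h \<in> (\<lambda>h. h \<circ> \<pi>) ` (I \<rightarrow>\<^sub>E A)" unfolding bij_betw_imp_surj_on[OF bij] by simp
    then show "h \<in> (\<lambda>h. h \<circ> \<pi>) ` {h \<in> I \<rightarrow>\<^sub>E A. P (h \<circ> \<pi>)}" using h by blast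
  next
    fix h assume "h \<in> (\<lambda>h. h \<circ> \<pi>) ` {h \<in> I \<rightarrow>\<^sub>E A. P (h \<circ> \<pi>)}"
    then obtain k where k: "h = k \<circ> \<pi>" "k \<in> I \<rightarrow>\<^sub>E A" "P (k \<circ> \<pi>)" by blast
    then show "h \<in> {h \<in> I \<rightarrow>\<^sub>E A. P h}" using comp_permutes_PiE[OF assms k(2)] by simp
  qed
  ultimately show ?thesis using card_image by fastforce
qed

lemma finite_maps [simp]: "finite ({k..s::nat} \<rightarrow>\<^sub>E {..<n::nat})"
  by (intro finite_PiE) auto

lemma inj_on_of_sorted:
  fixes v :: "nat \<Rightarrow> nat"
  assumes "\<pi> permutes {1..s}" "strict_mono_on {1..s} (\<lambda>t. v (\<pi> t))"
  shows "inj_on v {1..s}"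
  using assms(1) strict_mono_on_imp_inj_on[OF assms(2)]
  by (metis comp_def inj_on_imageI permutes_image inj_on_cong)

section \<open>Counting injective and increasing maps\<close>

lemma card_injections:
  "card {h \<in> {1..s} \<rightarrow>\<^sub>E {..<n}. inj_on h {1..s}} = fact s * (n choose s)"
proof -
  have "card {h \<in> {1..s} \<rightarrow>\<^sub>E {..<n}. inj_on h {1..s}} = (\<Prod>i = 0..<s. n - i)"
    by (subst card_inj_on_subset_funcset) auto
  also have "\<dots> = fact s * (n choose s)"
  proof (cases "s \<le> n")
    case True
    have "(\<Prod>i = 0..<s. n - i) = (\<Prod>{n - s + 1..n})"
      by (rule prod.reindex_bij_witness[where j = "\<lambda>i. n - i" and i = "\<lambda>i. n - i"])
        (use True in auto)
    also have "\<dots> * fact (n - s) = fact n"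
      using True fact_div_fact[of "n - s" n]
      by (metis fact_dvd diff_le_self dvd_div_mult_self Suc_eq_plus1)
    finally have "(\<Prod>i = 0..<s. n - i) * fact (n - s) = fact n" .
    moreover have "fact s * fact (n - s) * (n choose s) = fact n"
      using binomial_fact_lemma[OF True] .
    ultimately have "(\<Prod>i = 0..<s. n - i) * fact (n - s) = (fact s * (n choose s)) * fact (n - s)"
      by (simp add: mult_ac)
    then show ?thesis by simp
  next
    case False
    then show ?thesis by (auto simp: binomial_eq_0 intro!: bexI[of _ n])
  qed
  finally show ?thesis .
qed

text \<open>\<open>inv \<pi> i\<close> is the position of \<open>i\<close> in the sorted order.
  Comparisons of values thus become conditions on the sorting permutation alone, which lets order
  events be split by sorting permutations.\<close>

lemma sorted_less_iff_inv_less: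
  fixes v :: "nat \<Rightarrow> nat"
  assumes "\<pi> permutes {1..s}" "strict_mono_on {1..s} (\<lambda>t. v (\<pi> t))"
    and "i \<in> {1..s}" "j \<in> {1..s}"
  shows "v i < v j \<longleftrightarrow> inv \<pi> i < inv \<pi> j"
proof -
  have *: "inv \<pi> i \<in> {1..s}" "inv \<pi> j \<in> {1..s}" "\<pi> (inv \<pi> i) = i" "\<pi> (inv \<pi> j) = j"
    using assms permutes_in_image[OF permutes_inv[OF assms(1)]]
    by (auto simp: permutes_inverses)
  show ?thesis
    using strict_mono_on_less[OF assms(2) *(1,2)] *(3,4) by simp
qed

lemma inj_on_comp_permutes_maps:
  assumes "\<alpha> permutes B"
  shows "inj_on (\<lambda>t. \<alpha> (h t)) A \<longleftrightarrow> inj_on h A"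
  using permutes_inj[OF assms] by (auto simp: inj_on_def)

text \<open>The \<open>fact s * (n choose s)\<close> injections split into \<open>fact s\<close>
  classes by the permutation that sorts them along \<alpha>. Precomposition with a permutation
  carries one class onto another, so all are equally large.\<close>

lemma card_increasing:
  assumes "\<alpha> permutes {..<n}" "\<sigma> permutes {1..s}"
  shows "card {e \<in> {1..s} \<rightarrow>\<^sub>E {..<n}. strict_mono_on {1..s} (\<lambda>t. \<alpha> (e (\<sigma> t)))} = n choose s"
proof -
  let ?H = "{1..s} \<rightarrow>\<^sub>E {..<n}"
  let ?I = "\<lambda>\<pi>. {e \<in> ?H. strict_mono_on {1..s} (\<lambda>t. \<alpha> (e (\<pi> t)))}"
  have same: "card (?I \<pi>) = card (?I id)" if "\<pi> permutes {1..s}" for \<pi>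
    using card_comp_permutes_PiE[OF that, of "{..<n}" "\<lambda>h. strict_mono_on {1..s} (\<lambda>t. \<alpha> (h t))"]
    by simp
  have "{h \<in> ?H. inj_on h {1..s}} = (\<Union>\<pi>\<in>{\<pi>. \<pi> permutes {1..s}}. ?I \<pi>)"
  proof (intro set_eqI iffI)
    fix h assume h: "h \<in> {h \<in> ?H. inj_on h {1..s}}"
    then have "inj_on (\<lambda>t. \<alpha> (h t)) {1..s}" using inj_on_comp_permutes_maps[OF assms(1)] by blast
    then obtain \<pi> where "\<pi> permutes {1..s}" "strict_mono_on {1..s} (\<lambda>t. \<alpha> (h (\<pi> t)))"
      by (rule sorting_perm_exists)
    then show "h \<in> (\<Union>\<pi>\<in>{\<pi>. \<pi> permutes {1..s}}. ?I \<pi>)" using h by blast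
  next
    fix h assume "h \<in> (\<Union>\<pi>\<in>{\<pi>. \<pi> permutes {1..s}}. ?I \<pi>)"
    then obtain \<pi> where "\<pi> permutes {1..s}" "strict_mono_on {1..s} (\<lambda>t. \<alpha> (h (\<pi> t)))" "h \<in> ?H"
      by blast
    then have "inj_on (\<lambda>t. \<alpha> (h t)) {1..s}"
      by (intro inj_on_of_sorted[of _ _ "\<lambda>t. \<alpha> (h t)"])
    then show "h \<in> {h \<in> ?H. inj_on h {1..s}}"
      using inj_on_comp_permutes_maps[OF assms(1)] \<open>h \<in> ?H\<close> by blast
  qed
  then have "fact s * (n choose s) = card (\<Union>\<pi>\<in>{\<pi>. \<pi> permutes {1..s}}. ?I \<pi>)"
    using card_injections by metis
  also have "\<dots> = (\<Sum>\<pi>\<in>{\<pi>. \<pi> permutes {1..s}}. card (?I \<pi>))"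
  proof (intro card_UN_disjoint ballI impI)
    fix \<pi> \<rho> assume "\<pi> \<in> {\<pi>. \<pi> permutes {1..s}}" "\<rho> \<in> {\<pi>. \<pi> permutes {1..s}}" "\<pi> \<noteq> \<rho>"
    then show "?I \<pi> \<inter> ?I \<rho> = {}"
      using sorting_perm_unique[of \<pi> s "\<lambda>t. \<alpha> (_ t)" \<rho>] by blast
  qed (auto simp: finite_permutations)
  also have "\<dots> = (\<Sum>\<pi>\<in>{\<pi>. \<pi> permutes {1..s}}. card (?I id))"
    using same by (intro sum.cong) auto
  also have "\<dots> = fact s * card (?I id)"
    using card_permutations[of "{1..s}" s] by simp
  finally show ?thesis using same[OF assms(2)] by simp
qed

text \<open>The birthday bound: \<open>s\<close> independent uniform indices are distinct with
  probability equal to the product of the \<open>1 - i / n\<close> for \<open>i < s\<close>, which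
  the Weierstrass inequality bounds from below. For \<open>s > n\<close> the left side is not
  positive.\<close>

lemma injections_almost_all:
  assumes "n > 0"
  shows "1 - real s * real s / real n \<le> fact s * real (n choose s) / real n ^ s"
proof (cases "s \<le> n")
  case True
  have "fact s * real (n choose s) = real (card {h \<in> {1..s} \<rightarrow>\<^sub>E {..<n}. inj_on h {1..s}})"
    unfolding card_injections by simp
  also have "\<dots> = (\<Prod>i = 0..<s. real (n - i))"
    by (subst card_inj_on_subset_funcset) auto
  also have "\<dots> = (\<Prod>i = 0..<s. real n - real i)"
    using True by (intro prod.cong) auto
  finally have "fact s * real (n choose s) / real n ^ s = (\<Prod>i = 0..<s. (real n - real i) / real n)"
    by (simp add: prod_dividef)
  also have "\<dots> = (\<Prod>i = 0..<s. 1 - real i / real n)"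
    using assms by (intro prod.cong) (auto simp: field_simps)
  finally have "1 - (\<Sum>i = 0..<s. real i / real n) \<le> fact s * real (n choose s) / real n ^ s"
    using True assms Weierstrass_prod_ineq[of "{0..<s}" "\<lambda>i. real i / real n"] by simp
  moreover have "(\<Sum>i = 0..<s. real i / real n) \<le> (\<Sum>i = 0..<s. real s / real n)"
    by (intro sum_mono divide_right_mono) auto
  ultimately show ?thesis by simp
next
  case False
  then have "real n * 1 \<le> real s * real s" by (intro mult_mono) auto
  then have "1 \<le> real s * real s / real n" using assms by simp
  then show ?thesis by (smt (verit) divide_nonneg_nonneg fact_ge_zero mult_nonneg_nonneg of_nat_0_le_iff zero_le_power)
qed

section \<open>Pattern densities and order events for four points\<close>

definition pattern_count :: "nat \<Rightarrow> (nat \<Rightarrow> nat) \<Rightarrow> (nat \<Rightarrow> nat) \<Rightarrow> nat \<Rightarrow> (nat \<Rightarrow> nat) \<Rightarrow> nat" where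
  "pattern_count n \<alpha> \<beta> s \<sigma> = card {e \<in> {1..s} \<rightarrow>\<^sub>E {..<n}.
     strict_mono_on {1..s} (\<lambda>t. \<alpha> (e t)) \<and> strict_mono_on {1..s} (\<lambda>t. \<beta> (e (\<sigma> t)))}"

text \<open>For a permutation \<alpha>, each set of \<open>s\<close> indices has exactly one listing
  increasing along \<alpha>. So the count is one of subsets, hence the normalisation by
  \<open>n choose s\<close> and not by \<open>n ^ s\<close>.\<close>

definition pattern_density :: "nat \<Rightarrow> (nat \<Rightarrow> nat) \<Rightarrow> (nat \<Rightarrow> nat) \<Rightarrow> nat \<Rightarrow> (nat \<Rightarrow> nat) \<Rightarrow> real" where
  "pattern_density n \<alpha> \<beta> s \<sigma> = real (pattern_count n \<alpha> \<beta> s \<sigma>) / real (n choose s)"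

text \<open>Substituting \<open>e = h \<circ> \<pi>\<close> gives
  \<open>h \<circ> \<rho> = e \<circ> (inv \<pi> \<circ> \<rho>)\<close>: only the relative
  permutation of the two sorting orders matters.\<close>

lemma card_doubly_sorted:
  assumes "\<pi> permutes {1..s}"
  shows "card {h \<in> {1..s} \<rightarrow>\<^sub>E {..<n}. strict_mono_on {1..s} (\<lambda>t. \<alpha> (h (\<pi> t))) \<and>
            strict_mono_on {1..s} (\<lambda>t. \<beta> (h (\<rho> t)))} = pattern_count n \<alpha> \<beta> s (inv \<pi> \<circ> \<rho>)"
  using card_comp_permutes_PiE[OF assms, of "{..<n}" "\<lambda>e. strict_mono_on {1..s} (\<lambda>t. \<alpha> (e t)) \<and>
      strict_mono_on {1..s} (\<lambda>t. \<beta> (e ((inv \<pi> \<circ> \<rho>) t)))"]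
    permutes_inverses(1)[OF assms]
  unfolding pattern_count_def by simp

text \<open>The permutations sorting an injective \<open>v\<close> with \<open>v b < v a\<close> and \<open>v c < v a\<close>.\<close>

definition peak_perms :: "nat \<Rightarrow> nat \<Rightarrow> nat \<Rightarrow> (nat \<Rightarrow> nat) set" where
  "peak_perms a b c = {\<pi>. \<pi> permutes {1..4} \<and> inv \<pi> b < inv \<pi> a \<and> inv \<pi> c < inv \<pi> a}"

lemma finite_peak_perms: "finite (peak_perms a b c)"
  unfolding peak_perms_def by (rule finite_subset[OF _ finite_permutations[of "{1..4}"]]) auto

text \<open>Exactly one of \<open>a\<close>, \<open>b\<close>, \<open>c\<close> is ranked highest
  among the three. Composing with a transposition exchanges the roles of two of them, so the 24
  permutations fall into three classes of equal size.\<close>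

lemma card_peak_perms:
  assumes "a \<in> {1..4}" "b \<in> {1..4}" "c \<in> {1..4}" "distinct [a, b, c]"
  shows "card (peak_perms a b c) = 8"
proof -
  have le: "card (peak_perms x y z) \<le> card (peak_perms y x z)"
    if "x \<in> {1..4}" "y \<in> {1..4}" "distinct [x, y, z]" for x y z
  proof (rule card_inj_on_le[where f = "\<lambda>\<pi>. Transposition.transpose x y \<circ> \<pi>"])
    show "inj_on (\<lambda>\<pi>. Transposition.transpose x y \<circ> \<pi>) (peak_perms x y z)"
      by (intro inj_onI) (metis comp_assoc id_comp transpose_comp_involutory)
    show "(\<lambda>\<pi>. Transposition.transpose x y \<circ> \<pi>) ` peak_perms x y z \<subseteq> peak_perms y x z"
    proof (rule image_subsetI)
      fix \<pi> assume "\<pi> \<in> peak_perms x y z"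
      then have \<pi>: "\<pi> permutes {1..4}" "inv \<pi> y < inv \<pi> x" "inv \<pi> z < inv \<pi> x"
        by (auto simp: peak_perms_def)
      have p: "Transposition.transpose x y permutes {1..4}" using that by (intro permutes_swap_id) auto
      have i: "inv (Transposition.transpose x y \<circ> \<pi>) = inv \<pi> \<circ> Transposition.transpose x y"
        using \<pi>(1) p by (simp add: o_inv_distrib permutes_bij)
      show "Transposition.transpose x y \<circ> \<pi> \<in> peak_perms y x z"
        using \<pi> permutes_compose[OF \<pi>(1) p] that
        unfolding peak_perms_def mem_Collect_eq i comp_apply by simp
    qed
  qed (rule finite_peak_perms)
  have swap: "peak_perms x y z = peak_perms x z y" for x y z
    unfolding peak_perms_def by auto
  have eq: "card (peak_perms a b c) = card (peak_perms b a c)"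
    "card (peak_perms a b c) = card (peak_perms c a b)"
    using le[of a b c] le[of b a c] le[of a c b] le[of c a b] assms swap[of a b c]
    by (auto intro: antisym)
  have un: "{\<pi>. \<pi> permutes {1..4}} = peak_perms a b c \<union> peak_perms b a c \<union> peak_perms c a b"
  proof (intro set_eqI iffI)
    fix \<pi> :: "nat \<Rightarrow> nat" assume "\<pi> \<in> {\<pi>. \<pi> permutes {1..4}}"
    then have \<pi>: "\<pi> permutes {1..4}" by simp
    have "inj (inv \<pi>)" using permutes_inj[OF permutes_inv[OF \<pi>]] .
    then have "inv \<pi> a \<noteq> inv \<pi> b" "inv \<pi> a \<noteq> inv \<pi> c" "inv \<pi> b \<noteq> inv \<pi> c"
      using assms(4) by (auto dest: injD)
    then show "\<pi> \<in> peak_perms a b c \<union> peak_perms b a c \<union> peak_perms c a b"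
      using \<pi> unfolding peak_perms_def by auto
  qed (auto simp: peak_perms_def)
  have "24 = card {\<pi>. \<pi> permutes {1..4::nat}}"
    by (subst card_permutations[of _ 4]) (auto simp: fact_numeral)
  also have "\<dots> = card (peak_perms a b c) + card (peak_perms b a c) + card (peak_perms c a b)"
    unfolding un using finite_peak_perms
    by (subst card_Un_disjoint, simp, simp, force simp: peak_perms_def)+ simp
  finally show ?thesis using eq by simp
qed

text \<open>For four independent uniform points these are the events behind the integrals of the
  overview: \<open>1 2 3 1 2 3\<close> stands for \<integral> F^2 d\<mu>, \<open>1 2 3 1 2 4\<close>
  for \<integral> F x y d\<mu>, and, up to ties, \<open>1 3 4 2 3 4\<close> for \<integral> F^2
  d\<lambda>.\<close>

definition peak_maps :: "nat \<Rightarrow> (nat \<Rightarrow> nat) \<Rightarrow> (nat \<Rightarrow> nat) \<Rightarrow> nat \<Rightarrow> nat \<Rightarrow> nat \<Rightarrow> nat \<Rightarrow> nat \<Rightarrow> nat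
    \<Rightarrow> (nat \<Rightarrow> nat) set" where
  "peak_maps n \<alpha> \<beta> a b c a' b' c' = {h \<in> {1..4} \<rightarrow>\<^sub>E {..<n}.
     \<alpha> (h b) < \<alpha> (h a) \<and> \<alpha> (h c) < \<alpha> (h a) \<and> \<beta> (h b') < \<beta> (h a') \<and> \<beta> (h c') < \<beta> (h a')}"

text \<open>An injective \<open>h\<close> has a unique pair of permutations sorting its
  \<alpha>-values and its \<beta>-values, and the event depends on this pair alone. Each pair
  contributes one pattern count.\<close>

lemma card_inj_peak_maps:
  assumes "\<alpha> permutes {..<n}" "\<beta> permutes {..<n}" "{a, b, c, a', b', c'} \<subseteq> {1..4}"
  shows "card {h \<in> peak_maps n \<alpha> \<beta> a b c a' b' c'. inj_on h {1..4}} =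
    (\<Sum>\<pi>\<in>peak_perms a b c. \<Sum>\<rho>\<in>peak_perms a' b' c'. pattern_count n \<alpha> \<beta> 4 (inv \<pi> \<circ> \<rho>))"
proof -
  let ?H = "{1..4} \<rightarrow>\<^sub>E {..<n}"
  let ?N = "\<lambda>(\<pi>, \<rho>). {h \<in> ?H. strict_mono_on {1..4} (\<lambda>t. \<alpha> (h (\<pi> t))) \<and>
            strict_mono_on {1..4} (\<lambda>t. \<beta> (h (\<rho> t)))}"
  let ?P = "peak_perms a b c \<times> peak_perms a' b' c'"
  have "{h \<in> peak_maps n \<alpha> \<beta> a b c a' b' c'. inj_on h {1..4}} = (\<Union>p\<in>?P. ?N p)"
  proof (intro set_eqI iffI)
    fix h assume h: "h \<in> {h \<in> peak_maps n \<alpha> \<beta> a b c a' b' c'. inj_on h {1..4}}"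
    have "inj_on (\<lambda>t. \<alpha> (h t)) {1..4}" "inj_on (\<lambda>t. \<beta> (h t)) {1..4}"
      using h inj_on_comp_permutes_maps[OF assms(1)] inj_on_comp_permutes_maps[OF assms(2)] by blast+
    then obtain \<pi> where p1: "\<pi> permutes {1..4}" "strict_mono_on {1..4} (\<lambda>t. \<alpha> (h (\<pi> t)))"
      using sorting_perm_exists[of "\<lambda>t. \<alpha> (h t)" 4] by metis
    obtain \<rho> where p2: "\<rho> permutes {1..4}" "strict_mono_on {1..4} (\<lambda>t. \<beta> (h (\<rho> t)))"
      using sorting_perm_exists[OF \<open>inj_on (\<lambda>t. \<beta> (h t)) {1..4}\<close>] by metis
    note p = p1 p2
    have "(\<pi>, \<rho>) \<in> ?P"
      using h p assms(3) sorted_less_iff_inv_less[OF p(1), of "\<lambda>t. \<alpha> (h t)"]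
        sorted_less_iff_inv_less[OF p(3), of "\<lambda>t. \<beta> (h t)"]
      unfolding peak_perms_def peak_maps_def by auto
    then show "h \<in> (\<Union>p\<in>?P. ?N p)" using p h unfolding peak_maps_def by blast
  next
    fix h assume "h \<in> (\<Union>p\<in>?P. ?N p)"
    then obtain \<pi> \<rho> where p: "\<pi> \<in> peak_perms a b c" "\<rho> \<in> peak_perms a' b' c'" "h \<in> ?N (\<pi>, \<rho>)"
      by blast
    then have p': "\<pi> permutes {1..4}" "strict_mono_on {1..4} (\<lambda>t. \<alpha> (h (\<pi> t)))"
      "\<rho> permutes {1..4}" "strict_mono_on {1..4} (\<lambda>t. \<beta> (h (\<rho> t)))"
      by (auto simp: peak_perms_def)
    have "inj_on (\<lambda>t. \<alpha> (h t)) {1..4}"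
      using p' by (intro inj_on_of_sorted[of _ _ "\<lambda>t. \<alpha> (h t)"])
    then have "inj_on h {1..4}"
      using inj_on_comp_permutes_maps[OF assms(1)] by blast
    moreover have "h \<in> peak_maps n \<alpha> \<beta> a b c a' b' c'"
      using p p' assms(3) sorted_less_iff_inv_less[OF p'(1), of "\<lambda>t. \<alpha> (h t)"]
        sorted_less_iff_inv_less[OF p'(3), of "\<lambda>t. \<beta> (h t)"]
      unfolding peak_perms_def peak_maps_def by auto
    ultimately show "h \<in> {h \<in> peak_maps n \<alpha> \<beta> a b c a' b' c'. inj_on h {1..4}}" by blast
  qed
  then have "card {h \<in> peak_maps n \<alpha> \<beta> a b c a' b' c'. inj_on h {1..4}} = card (\<Union>p\<in>?P. ?N p)"
    by simp
  also have "\<dots> = (\<Sum>p\<in>?P. card (?N p))"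
  proof (intro card_UN_disjoint ballI impI)
    fix p q assume "p \<in> ?P" "q \<in> ?P" "p \<noteq> q"
    then show "?N p \<inter> ?N q = {}"
      using sorting_perm_unique[of "fst p" 4 "\<lambda>t. \<alpha> (_ t)" "fst q"]
        sorting_perm_unique[of "snd p" 4 "\<lambda>t. \<beta> (_ t)" "snd q"]
      unfolding peak_perms_def by (cases p; cases q) fastforce
  qed (auto simp: finite_peak_perms)
  also have "\<dots> = (\<Sum>p\<in>?P. pattern_count n \<alpha> \<beta> 4 (inv (fst p) \<circ> snd p))"
    using card_doubly_sorted[of _ 4 n \<alpha> \<beta>]
    by (intro sum.cong refl) (auto simp: peak_perms_def)
  also have "\<dots> = (\<Sum>\<pi>\<in>peak_perms a b c. \<Sum>\<rho>\<in>peak_perms a' b' c'. pattern_count n \<alpha> \<beta> 4 (inv \<pi> \<circ> \<rho>))"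
    by (simp add: sum.cartesian_product case_prod_beta)
  finally show ?thesis .
qed

section \<open>Replacing sampled points by uniform points\<close>

lemma sum_PiE_insert:
  fixes f :: "('i \<Rightarrow> 'a) \<Rightarrow> real"
  assumes "i \<notin> I"
  shows "(\<Sum>z\<in>insert i I \<rightarrow>\<^sub>E S. f z) = (\<Sum>p\<in>S. \<Sum>z\<in>I \<rightarrow>\<^sub>E S. f (z(i := p)))"
proof -
  have "(\<Sum>z\<in>insert i I \<rightarrow>\<^sub>E S. f z) = (\<Sum>(p, z)\<in>S \<times> (I \<rightarrow>\<^sub>E S). f (z(i := p)))"
    unfolding PiE_insert_eq
    using inj_combinator[OF assms, of "\<lambda>_. S"]
    by (subst sum.reindex) (auto simp: case_prod_beta' intro!: sum.cong)
  then show ?thesis by (simp add: sum.cartesian_product)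
qed

text \<open>Coordinates are exchanged one at a time; each exchange costs at most \<open>\<eta>\<close>.\<close>

lemma product_weights_hybrid:
  fixes w w' :: "'a \<Rightarrow> real"
  assumes "finite I" "finite S"
    and "\<And>p. p \<in> S \<Longrightarrow> 0 \<le> w p" "\<And>p. p \<in> S \<Longrightarrow> 0 \<le> w' p" "sum w S = 1" "sum w' S = 1"
    and "\<And>i z. i \<in> I \<Longrightarrow> \<bar>\<Sum>p\<in>S. (w p - w' p) * of_bool (T (z(i := p)))\<bar> \<le> \<eta>"
  shows "\<bar>\<Sum>z\<in>I \<rightarrow>\<^sub>E S. ((\<Prod>i\<in>I. w (z i)) - (\<Prod>i\<in>I. w' (z i))) * of_bool (T z)\<bar> \<le> real (card I) * \<eta>"
  using assms(1,7)
proof (induction I arbitrary: T rule: finite_induct)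
  case empty
  then show ?case by simp
next
  case (insert i I)
  let ?W = "\<lambda>z. \<Prod>j\<in>I. w (z j)" and ?W' = "\<lambda>z. \<Prod>j\<in>I. w' (z j)"
  let ?Z = "I \<rightarrow>\<^sub>E S"
  have upd: "(\<Prod>j\<in>insert i I. v ((z(i := p)) j)) = v p * (\<Prod>j\<in>I. v (z j))" for v :: "'a \<Rightarrow> real" and z p
  proof -
    have "(\<Prod>j\<in>I. v ((z(i := p)) j)) = (\<Prod>j\<in>I. v (z j))"
      using insert.hyps by (intro prod.cong) auto
    then show ?thesis using insert.hyps by simp
  qed
  have "(\<Sum>z\<in>insert i I \<rightarrow>\<^sub>E S. ((\<Prod>i\<in>insert i I. w (z i)) - (\<Prod>i\<in>insert i I. w' (z i))) * of_bool (T z))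
     = (\<Sum>p\<in>S. \<Sum>z\<in>?Z. (w p * ?W z - w' p * ?W' z) * of_bool (T (z(i := p))))"
    unfolding sum_PiE_insert[OF insert.hyps(2)] upd ..
  \<comment> \<open>The mixed term \<open>w' p * W\<close> is subtracted and added: the first part
    exchanges coordinate \<open>i\<close>, the second is left to the induction hypothesis.\<close>
  also have "\<dots> = (\<Sum>p\<in>S. \<Sum>z\<in>?Z. ?W z * ((w p - w' p) * of_bool (T (z(i := p)))))
      + (\<Sum>p\<in>S. \<Sum>z\<in>?Z. w' p * ((?W z - ?W' z) * of_bool (T (z(i := p)))))"
    unfolding sum.distrib[symmetric] by (intro sum.cong refl) (simp add: algebra_simps)
  also have "(\<Sum>p\<in>S. \<Sum>z\<in>?Z. ?W z * ((w p - w' p) * of_bool (T (z(i := p)))))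
      = (\<Sum>z\<in>?Z. ?W z * (\<Sum>p\<in>S. (w p - w' p) * of_bool (T (z(i := p)))))"
    by (subst sum.swap) (simp add: sum_distrib_left)
  also have "(\<Sum>p\<in>S. \<Sum>z\<in>?Z. w' p * ((?W z - ?W' z) * of_bool (T (z(i := p)))))
      = (\<Sum>p\<in>S. w' p * (\<Sum>z\<in>?Z. (?W z - ?W' z) * of_bool (T (z(i := p)))))"
    by (simp add: sum_distrib_left)
  finally have eq: "(\<Sum>z\<in>insert i I \<rightarrow>\<^sub>E S. ((\<Prod>i\<in>insert i I. w (z i)) - (\<Prod>i\<in>insert i I. w' (z i))) * of_bool (T z))
    = (\<Sum>z\<in>?Z. ?W z * (\<Sum>p\<in>S. (w p - w' p) * of_bool (T (z(i := p)))))
      + (\<Sum>p\<in>S. w' p * (\<Sum>z\<in>?Z. (?W z - ?W' z) * of_bool (T (z(i := p)))))" .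
  have W_nonneg: "0 \<le> ?W z" if "z \<in> ?Z" for z
    using that assms(3) by (intro prod_nonneg) auto
  have "\<bar>\<Sum>p\<in>S. (w p - w' p) * of_bool (T (z(i := p)))\<bar> \<le> \<eta>" for z
    using insert.prems[of i z] by blast
  then have "\<bar>\<Sum>z\<in>?Z. ?W z * (\<Sum>p\<in>S. (w p - w' p) * of_bool (T (z(i := p))))\<bar> \<le> (\<Sum>z\<in>?Z. ?W z * \<eta>)"
    using W_nonneg
    by (intro order.trans[OF sum_abs] sum_mono) (auto simp: abs_mult intro!: mult_left_mono)
  also have "\<dots> = \<eta>"
    using prod_sum_PiE[of I "\<lambda>_. S" "\<lambda>_. w"] insert.hyps assms(2,5)
    by (simp flip: sum_distrib_right)
  finally have 1: "\<bar>\<Sum>z\<in>?Z. ?W z * (\<Sum>p\<in>S. (w p - w' p) * of_bool (T (z(i := p))))\<bar> \<le> \<eta>" .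
  \<comment> \<open>The induction hypothesis is applied to the event with coordinate
    \<open>i\<close> frozen at \<open>p\<close>, which is why \<open>T\<close> is arbitrary in the
    induction.\<close>
  have "\<bar>\<Sum>z\<in>?Z. (?W z - ?W' z) * of_bool (T (z(i := p)))\<bar> \<le> real (card I) * \<eta>" for p
  proof (rule insert.IH)
    fix j z assume "j \<in> I"
    then have "j \<noteq> i" using insert.hyps by auto
    then have twist: "(z(j := q))(i := p) = (z(i := p))(j := q)" for q by (simp add: fun_upd_twist)
    show "\<bar>\<Sum>q\<in>S. (w q - w' q) * of_bool (T ((z(j := q))(i := p)))\<bar> \<le> \<eta>"
      unfolding twist by (rule insert.prems) (use \<open>j \<in> I\<close> in simp)
  qed
  then have "\<bar>\<Sum>p\<in>S. w' p * (\<Sum>z\<in>?Z. (?W z - ?W' z) * of_bool (T (z(i := p))))\<bar>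
      \<le> (\<Sum>p\<in>S. w' p * (real (card I) * \<eta>))"
    using assms(4)
    by (intro order.trans[OF sum_abs] sum_mono) (auto simp: abs_mult intro!: mult_left_mono)
  also have "\<dots> = real (card I) * \<eta>"
    using assms(6) by (simp flip: sum_distrib_right)
  finally have 2: "\<bar>\<Sum>p\<in>S. w' p * (\<Sum>z\<in>?Z. (?W z - ?W' z) * of_bool (T (z(i := p))))\<bar>
      \<le> real (card I) * \<eta>" .
  show ?case unfolding eq using 1 2 insert.hyps by (simp add: algebra_simps)
qed

text \<open>F - x y of the overview at the grid point x = a / n, y = b / n. With strict inequalities
  it vanishes for \<open>a = 0\<close> and for \<open>b = 0\<close>.\<close>

definition discrepancy :: "nat \<Rightarrow> (nat \<Rightarrow> nat) \<Rightarrow> (nat \<Rightarrow> nat) \<Rightarrow> nat \<Rightarrow> nat \<Rightarrow> real" where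
  "discrepancy n \<alpha> \<beta> a b =
     real (card {h. h < n \<and> \<alpha> h < a \<and> \<beta> h < b}) / real n - real a * real b / (real n)\<^sup>2"

section \<open>Slices of a pattern event are rectangles\<close>

lemma convex_nat_set_eq_interval:
  fixes X :: "nat set"
  assumes "X \<subseteq> {..<n}" and "\<And>x y z. x \<in> X \<Longrightarrow> z \<in> X \<Longrightarrow> x \<le> y \<Longrightarrow> y \<le> z \<Longrightarrow> y \<in> X"
  obtains a b where "a \<le> b" "b \<le> n" "X = {a..<b}"
proof (cases "X = {}")
  case True
  then show ?thesis using that[of 0 0] by simp
next
  case False
  have fin: "finite X" using assms(1) finite_subset by auto
  have *: "Min X \<in> X" "Max X \<in> X" using False fin by auto
  have "X = {Min X..<Suc (Max X)}"
    using fin assms(2)[OF *] by (auto simp: less_Suc_eq_le)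
  moreover have "Max X < n" using *(2) assms(1) by blast
  moreover have "Min X \<le> Max X" using *(1) fin by simp
  ultimately show ?thesis using that[of "Min X" "Suc (Max X)"] by simp
qed

text \<open>As \<sigma> is injective, the changed coordinate occurs on at most one side of each
  comparison. Each comparison bounds it from one side only, so the admissible values are
  order-convex.\<close>

lemma strict_mono_on_update_convex:
  fixes v \<sigma> :: "nat \<Rightarrow> nat"
  assumes "inj_on \<sigma> A" "x \<le> y" "y \<le> z"
    and "strict_mono_on A (\<lambda>t. (v(i := x)) (\<sigma> t))" "strict_mono_on A (\<lambda>t. (v(i := z)) (\<sigma> t))"
  shows "strict_mono_on A (\<lambda>t. (v(i := y)) (\<sigma> t))"
proof (rule strict_mono_onI)
  fix t u assume tu: "t \<in> A" "u \<in> A" "t < u"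
  then have "\<sigma> t \<noteq> \<sigma> u" using assms(1) by (auto dest: inj_onD)
  moreover have "(v(i := x)) (\<sigma> t) < (v(i := x)) (\<sigma> u)" "(v(i := z)) (\<sigma> t) < (v(i := z)) (\<sigma> u)"
    using assms(4,5) tu unfolding monotone_on_def by blast+
  ultimately show "(v(i := y)) (\<sigma> t) < (v(i := y)) (\<sigma> u)"
    using assms(2,3) by (auto split: if_splits)
qed

text \<open>The measure \<mu> of the overview as a weight on the grid; its counterpart for \<lambda>
  is the constant weight 1 / n^2.\<close>

definition graph_weight :: "nat \<Rightarrow> (nat \<Rightarrow> nat) \<Rightarrow> (nat \<Rightarrow> nat) \<Rightarrow> nat \<times> nat \<Rightarrow> real" where
  "graph_weight n \<alpha> \<beta> p = of_bool (\<exists>h<n. p = (\<alpha> h, \<beta> h)) / real n"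

lemma sum_graph_weight:
  assumes "\<alpha> permutes {..<n}" "finite A"
  shows "(\<Sum>p\<in>A. graph_weight n \<alpha> \<beta> p) = real (card {h. h < n \<and> (\<alpha> h, \<beta> h) \<in> A}) / real n"
proof -
  have "(\<Sum>p\<in>A. graph_weight n \<alpha> \<beta> p) = real (card {p \<in> A. \<exists>h<n. p = (\<alpha> h, \<beta> h)}) / real n"
    unfolding graph_weight_def using assms(2) by (simp add: Int_def flip: sum_divide_distrib)
  also have "{p \<in> A. \<exists>h<n. p = (\<alpha> h, \<beta> h)} = (\<lambda>h. (\<alpha> h, \<beta> h)) ` {h. h < n \<and> (\<alpha> h, \<beta> h) \<in> A}"
    by auto
  also have "card \<dots> = card {h. h < n \<and> (\<alpha> h, \<beta> h) \<in> A}"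
    using permutes_inj[OF assms(1)] by (intro card_image) (auto simp: inj_on_def)
  finally show ?thesis .
qed

text \<open>Inclusion-exclusion over the four corners. This is the source of the factor 4 in the
  later error bounds.\<close>

lemma sum_weight_rectangle:
  assumes "\<alpha> permutes {..<n}" "a \<le> b" "c \<le> d"
  shows "(\<Sum>p\<in>{a..<b} \<times> {c..<d}. graph_weight n \<alpha> \<beta> p - 1 / (real n)\<^sup>2) =
    discrepancy n \<alpha> \<beta> b d - discrepancy n \<alpha> \<beta> a d - discrepancy n \<alpha> \<beta> b c + discrepancy n \<alpha> \<beta> a c"
proof -
  let ?f = "\<lambda>p. graph_weight n \<alpha> \<beta> p - 1 / (real n)\<^sup>2"
  have corner: "(\<Sum>x<a. \<Sum>y<b. ?f (x, y)) = discrepancy n \<alpha> \<beta> a b" for a b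
  proof -
    have "(\<Sum>x<a. \<Sum>y<b. ?f (x, y)) = (\<Sum>p\<in>{..<a} \<times> {..<b}. ?f p)"
      by (simp add: sum.cartesian_product)
    also have "\<dots> = (\<Sum>p\<in>{..<a} \<times> {..<b}. graph_weight n \<alpha> \<beta> p) - real a * real b / (real n)\<^sup>2"
      by (simp add: sum_subtractf)
    finally show ?thesis
      by (simp add: sum_graph_weight[OF assms(1)] discrepancy_def)
  qed
  have iv: "(\<Sum>x\<in>{a..<b}. g x) = (\<Sum>x<b. g x) - (\<Sum>x<a. g x)" if "a \<le> b" for a b and g :: "nat \<Rightarrow> real"
    using that sum_diff_nat_ivl[of 0 a b g] by (simp add: atLeast0LessThan)
  have "(\<Sum>p\<in>{a..<b} \<times> {c..<d}. ?f p) = (\<Sum>x\<in>{a..<b}. \<Sum>y\<in>{c..<d}. ?f (x, y))"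
    by (simp add: sum.cartesian_product)
  also have "\<dots> = (\<Sum>x\<in>{a..<b}. (\<Sum>y<d. ?f (x, y)) - (\<Sum>y<c. ?f (x, y)))"
    using iv[OF assms(3)] by simp
  also have "\<dots> = discrepancy n \<alpha> \<beta> b d - discrepancy n \<alpha> \<beta> a d - discrepancy n \<alpha> \<beta> b c + discrepancy n \<alpha> \<beta> a c"
    unfolding iv[OF assms(2)] sum_subtractf[of "\<lambda>x. \<Sum>y<d. ?f (x, y)" "\<lambda>x. \<Sum>y<c. ?f (x, y)"] corner by simp
  finally show ?thesis .
qed

text \<open>With all sampled points but one fixed, the admissible positions of the last one form a
  rectangle, whose two weights differ by at most \<open>4 * \<delta>\<close>; exchanging
  \<open>s\<close> points gives the bound. The comparison value is exact for uniform points of the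
  grid: abscissae and ordinates are then independent, and each family has the prescribed order with
  probability \<open>(n choose s) / n ^ s\<close>.\<close>

lemma pattern_count_near_product:
  assumes "\<alpha> permutes {..<n}" "\<beta> permutes {..<n}" "\<sigma> permutes {1..s}" "n > 0"
    and \<delta>: "\<And>a b. a \<le> n \<Longrightarrow> b \<le> n \<Longrightarrow> \<bar>discrepancy n \<alpha> \<beta> a b\<bar> \<le> \<delta>"
  shows "\<bar>real (pattern_count n \<alpha> \<beta> s \<sigma>) / real n ^ s - (real (n choose s) / real n ^ s)\<^sup>2\<bar>
    \<le> 4 * real s * \<delta>"
proof -
  let ?S = "{..<n} \<times> {..<n}" and ?I = "{1..s}"
  let ?w = "graph_weight n \<alpha> \<beta>" and ?w' = "\<lambda>p::nat\<times>nat. 1 / (real n)\<^sup>2"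
  define T where "T z \<longleftrightarrow> strict_mono_on ?I (\<lambda>t. fst (z t)) \<and> strict_mono_on ?I (\<lambda>t. snd (z (\<sigma> t)))"
    for z :: "nat \<Rightarrow> nat \<times> nat"
  have "{h. h < n \<and> (\<alpha> h, \<beta> h) \<in> ?S} = {..<n}"
    using permutes_in_image[OF assms(1)] permutes_in_image[OF assms(2)] by auto
  then have sum_w: "sum ?w ?S = 1" using sum_graph_weight[OF assms(1), of ?S] assms(4) by simp
  have sum_w': "sum ?w' ?S = 1" using assms(4) by (simp add: power2_eq_square)
  have sect: "\<bar>\<Sum>p\<in>?S. (?w p - ?w' p) * of_bool (T (z(i := p)))\<bar> \<le> 4 * \<delta>" for i z
  proof -
    let ?x = "\<lambda>j. fst (z j)" and ?y = "\<lambda>j. snd (z j)"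
    define X where "X = {x. x < n \<and> strict_mono_on ?I (\<lambda>t. (?x(i := x)) t)}"
    define Y where "Y = {y. y < n \<and> strict_mono_on ?I (\<lambda>t. (?y(i := y)) (\<sigma> t))}"
    obtain a b where ab: "a \<le> b" "b \<le> n" "X = {a..<b}"
    proof (rule convex_nat_set_eq_interval[of X n])
      fix x y z assume "x \<in> X" "z \<in> X" "x \<le> y" "y \<le> z"
      then show "y \<in> X"
        using strict_mono_on_update_convex[of "\<lambda>t. t" ?I x y z ?x i] unfolding X_def
        by (auto simp del: fun_upd_apply)
    qed (auto simp: X_def)
    obtain c d where cd: "c \<le> d" "d \<le> n" "Y = {c..<d}"
    proof (rule convex_nat_set_eq_interval[of Y n])
      fix x y z assume "x \<in> Y" "z \<in> Y" "x \<le> y" "y \<le> z"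
      then show "y \<in> Y"
        using strict_mono_on_update_convex[OF permutes_inj_on[OF assms(3)], of x y z ?I ?y i]
        unfolding Y_def by auto
    qed (auto simp: Y_def)
    have upd: "(\<lambda>t. fst ((z(i := p)) t)) = (\<lambda>t. (?x(i := fst p)) t)"
      "(\<lambda>t. snd ((z(i := p)) (\<sigma> t))) = (\<lambda>t. (?y(i := snd p)) (\<sigma> t))" for p
      by auto
    \<comment> \<open>One monotonicity condition involves only the abscissa of \<open>p\<close>, the
      other only its ordinate, hence a product set.\<close>
    have "T (z(i := p)) \<longleftrightarrow> p \<in> X \<times> Y" if "p \<in> ?S" for p
      using that unfolding T_def upd X_def Y_def by (cases p) simp
    then have "(\<Sum>p\<in>?S. (?w p - ?w' p) * of_bool (T (z(i := p)))) = (\<Sum>p\<in>?S. if p \<in> X \<times> Y then ?w p - ?w' p else 0)"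
      by (intro sum.cong) auto
    also have "\<dots> = (\<Sum>p\<in>X \<times> Y. ?w p - ?w' p)"
      by (subst sum.inter_restrict[symmetric]) (auto simp: X_def Y_def intro!: sum.cong)
    also have "\<dots> = discrepancy n \<alpha> \<beta> b d - discrepancy n \<alpha> \<beta> a d - discrepancy n \<alpha> \<beta> b c + discrepancy n \<alpha> \<beta> a c"
      unfolding ab(3) cd(3) by (rule sum_weight_rectangle[OF assms(1) ab(1) cd(1)])
    finally show ?thesis
      using \<delta>[of b d] \<delta>[of a d] \<delta>[of b c] \<delta>[of a c] ab(1,2) cd(1,2) by auto
  qed
  have "\<bar>\<Sum>z\<in>?I \<rightarrow>\<^sub>E ?S. ((\<Prod>i\<in>?I. ?w (z i)) - (\<Prod>i\<in>?I. ?w' (z i))) * of_bool (T z)\<bar>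
      \<le> real (card ?I) * (4 * \<delta>)"
    by (rule product_weights_hybrid) (use sect sum_w sum_w' in \<open>auto simp: graph_weight_def\<close>)
  moreover have "(\<Sum>z\<in>?I \<rightarrow>\<^sub>E ?S. (\<Prod>i\<in>?I. ?w (z i)) * of_bool (T z)) = real (pattern_count n \<alpha> \<beta> s \<sigma>) / real n ^ s"
  proof -
    let ?E = "{e \<in> ?I \<rightarrow>\<^sub>E {..<n}. strict_mono_on ?I (\<lambda>t. \<alpha> (e t)) \<and> strict_mono_on ?I (\<lambda>t. \<beta> (e (\<sigma> t)))}"
    let ?g = "\<lambda>e. \<lambda>t\<in>?I. (\<alpha> (e t), \<beta> (e t))"
    let ?Z = "{z \<in> ?I \<rightarrow>\<^sub>E ?S. (\<forall>i\<in>?I. \<exists>h<n. z i = (\<alpha> h, \<beta> h)) \<and> T z}"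
    have "(\<Prod>i\<in>?I. ?w (z i)) * of_bool (T z) = of_bool (z \<in> ?Z) / real n ^ s"
      if z: "z \<in> ?I \<rightarrow>\<^sub>E ?S" for z
    proof (cases "\<forall>i\<in>?I. \<exists>h<n. z i = (\<alpha> h, \<beta> h)")
      case True
      then have "(\<Prod>i\<in>?I. ?w (z i)) = (\<Prod>i\<in>?I. 1 / real n)"
        unfolding graph_weight_def by (intro prod.cong refl) simp
      then show ?thesis using True z by (simp add: power_one_over)
    next
      case False
      then have "(\<Prod>i\<in>?I. ?w (z i)) = 0"
        unfolding graph_weight_def by (intro prod_zero) auto
      then show ?thesis using False by auto
    qed
    then have "(\<Sum>z\<in>?I \<rightarrow>\<^sub>E ?S. (\<Prod>i\<in>?I. ?w (z i)) * of_bool (T z)) = (\<Sum>z\<in>?I \<rightarrow>\<^sub>E ?S. of_bool (z \<in> ?Z) / real n ^ s)"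
      by (intro sum.cong refl) blast
    also have "\<dots> = real (card ?Z) / real n ^ s"
    proof -
      have "(?I \<rightarrow>\<^sub>E ?S) \<inter> ?Z = ?Z" by blast
      moreover have "finite (?I \<rightarrow>\<^sub>E ?S)" by (intro finite_PiE) auto
      ultimately show ?thesis by (simp add: sum_divide_distrib[symmetric] Int_def)
    qed
    also have "card ?Z = card ?E"
    proof -
      have inj: "inj_on ?g ?E"
      proof (rule inj_onI)
        fix e f assume ef: "e \<in> ?E" "f \<in> ?E" "?g e = ?g f"
        show "e = f"
        proof (rule extensionalityI[of e ?I f])
          fix t assume "t \<in> ?I"
          then have "\<alpha> (e t) = \<alpha> (f t)" using fun_cong[OF ef(3), of t] by simp
          then show "e t = f t" using permutes_inj[OF assms(1)] by (simp add: inj_eq)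
        qed (use ef in \<open>auto simp: PiE_iff\<close>)
      qed
      have \<sigma>: "\<sigma> t \<in> ?I \<longleftrightarrow> t \<in> ?I" for t using permutes_in_image[OF assms(3)] .
      have T_g: "T (?g e) \<longleftrightarrow> strict_mono_on ?I (\<lambda>t. \<alpha> (e t)) \<and> strict_mono_on ?I (\<lambda>t. \<beta> (e (\<sigma> t)))" for e
        unfolding T_def monotone_on_def using \<sigma> by auto
      have "?g ` ?E = ?Z"
      proof (intro set_eqI iffI)
        fix z assume "z \<in> ?g ` ?E"
        then obtain e where e: "e \<in> ?E" "z = ?g e" by blast
        have "T z" using T_g e by simp
        moreover have "z \<in> ?I \<rightarrow>\<^sub>E ?S"
          using e permutes_in_image[OF assms(1)] permutes_in_image[OF assms(2)] by auto
        moreover have "\<forall>i\<in>?I. \<exists>h<n. z i = (\<alpha> h, \<beta> h)" using e by auto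
        ultimately show "z \<in> ?Z" by blast
      next
        fix z assume z: "z \<in> ?Z"
        then have "\<forall>i\<in>?I. \<exists>h. h < n \<and> z i = (\<alpha> h, \<beta> h)" by blast
        from bchoice[OF this] obtain k where k: "\<And>i. i \<in> ?I \<Longrightarrow> k i < n \<and> z i = (\<alpha> (k i), \<beta> (k i))"
          by blast
        let ?e = "restrict k ?I"
        have "z = ?g ?e"
        proof (rule extensionalityI[of z ?I])
          show "z t = ?g ?e t" if "t \<in> ?I" for t using k[OF that] that by simp
        qed (use z in \<open>auto simp: PiE_iff\<close>)
        moreover have "?e \<in> ?I \<rightarrow>\<^sub>E {..<n}" using k by auto
        moreover have "T (?g ?e)" using calculation(1) z by blast
        ultimately show "z \<in> ?g ` ?E" using T_g[of ?e] by blast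
      qed
      then show ?thesis using card_image[OF inj] by simp
    qed
    finally show ?thesis unfolding pattern_count_def .
  qed
  moreover have "(\<Sum>z\<in>?I \<rightarrow>\<^sub>E ?S. (\<Prod>i\<in>?I. ?w' (z i)) * of_bool (T z)) = (real (n choose s) / real n ^ s)\<^sup>2"
  proof -
    let ?A = "{e \<in> ?I \<rightarrow>\<^sub>E {..<n}. strict_mono_on ?I (\<lambda>t. e t)}"
    let ?B = "{e \<in> ?I \<rightarrow>\<^sub>E {..<n}. strict_mono_on ?I (\<lambda>t. e (\<sigma> t))}"
    let ?Z = "{z \<in> ?I \<rightarrow>\<^sub>E ?S. T z}"
    let ?g = "\<lambda>(x, y). \<lambda>t\<in>?I. (x t, y t)"
    have fin: "finite (?I \<rightarrow>\<^sub>E ?S)" by (intro finite_PiE) auto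
    have \<sigma>: "\<sigma> t \<in> ?I \<longleftrightarrow> t \<in> ?I" for t using permutes_in_image[OF assms(3)] .
    have T_g: "T (?g (x, y)) \<longleftrightarrow> strict_mono_on ?I (\<lambda>t. x t) \<and> strict_mono_on ?I (\<lambda>t. y (\<sigma> t))"
      for x y unfolding T_def monotone_on_def using \<sigma> by auto
    have inj: "inj_on ?g (?A \<times> ?B)"
    proof (rule inj_onI)
      fix p q assume pq: "p \<in> ?A \<times> ?B" "q \<in> ?A \<times> ?B" "?g p = ?g q"
      obtain x y x' y' where p: "p = (x, y)" "q = (x', y')" by (cases p; cases q)
      have *: "x t = x' t" "y t = y' t" if "t \<in> ?I" for t
        using fun_cong[OF pq(3), of t] that unfolding p by auto
      have "x = x'" using pq * unfolding p
        by (intro extensionalityI[of x ?I x']) (auto simp: PiE_iff)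
      moreover have "y = y'" using pq * unfolding p
        by (intro extensionalityI[of y ?I y']) (auto simp: PiE_iff)
      ultimately show "p = q" using p by simp
    qed
    have "?g ` (?A \<times> ?B) = ?Z"
    proof (intro set_eqI iffI)
      fix z assume "z \<in> ?g ` (?A \<times> ?B)"
      then obtain x y where xy: "x \<in> ?A" "y \<in> ?B" "z = ?g (x, y)" by blast
      have "z \<in> ?I \<rightarrow>\<^sub>E ?S" using xy by auto
      then show "z \<in> ?Z" using T_g[of x y] xy by blast
    next
      fix z assume z: "z \<in> ?Z"
      let ?x = "\<lambda>t\<in>?I. fst (z t)" and ?y = "\<lambda>t\<in>?I. snd (z t)"
      have zi: "z t \<in> ?S" if "t \<in> ?I" for t using z that PiE_mem[of z ?I "\<lambda>_. ?S"] by blast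
      have "z = ?g (?x, ?y)"
      proof (rule extensionalityI[of z ?I])
        show "z t = ?g (?x, ?y) t" if "t \<in> ?I" for t using that by simp
      qed (use z in \<open>auto simp: PiE_iff\<close>)
      moreover have "?x \<in> ?I \<rightarrow>\<^sub>E {..<n}" "?y \<in> ?I \<rightarrow>\<^sub>E {..<n}"
        using zi by (auto simp: mem_Times_iff)
      moreover have "T (?g (?x, ?y))" using calculation(1) z by simp
      ultimately show "z \<in> ?g ` (?A \<times> ?B)" using T_g[of ?x ?y] by blast
    qed
    then have "card ?Z = card ?A * card ?B"
      using card_image[OF inj] by (simp add: card_cartesian_product)
    also have "card ?A = n choose s"
      using card_increasing[OF permutes_id permutes_id, of s n] by simp
    also have "card ?B = n choose s"
      using card_increasing[OF permutes_id assms(3), of n] by simp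
    finally have "card ?Z = (n choose s) * (n choose s)" .
    then have "(\<Sum>z\<in>?I \<rightarrow>\<^sub>E ?S. of_bool (T z)) = real (n choose s) * real (n choose s)"
      using fin by (simp add: Int_def)
    then have "(\<Sum>z\<in>?I \<rightarrow>\<^sub>E ?S. (\<Prod>i\<in>?I. ?w' (z i)) * of_bool (T z))
        = (1 / (real n)\<^sup>2) ^ s * (real (n choose s) * real (n choose s))"
      by (simp flip: sum_distrib_left)
    then show ?thesis by (simp add: power_divide power2_eq_square power_mult_distrib)
  qed
  ultimately show ?thesis
    by (simp add: left_diff_distrib sum_subtractf)
qed

section \<open>The discrepancy function\<close>

text \<open>The integral of (F - x y)^2 against \<lambda> as a Riemann sum; the omitted lines
  \<open>a = 0\<close> and \<open>b = 0\<close> carry discrepancy 0.\<close>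

definition mean_square_discrepancy :: "nat \<Rightarrow> (nat \<Rightarrow> nat) \<Rightarrow> (nat \<Rightarrow> nat) \<Rightarrow> real" where
  "mean_square_discrepancy n \<alpha> \<beta> =
     (\<Sum>a = 1..n. \<Sum>b = 1..n. (discrepancy n \<alpha> \<beta> a b)\<^sup>2) / (real n)\<^sup>2"

lemma mean_square_discrepancy_nonneg: "0 \<le> mean_square_discrepancy n \<alpha> \<beta>"
  unfolding mean_square_discrepancy_def by (intro divide_nonneg_nonneg sum_nonneg) auto

section \<open>Lipschitz continuity and the uniform bound\<close>

lemma card_less_permutes_diff:
  assumes "\<alpha> permutes {..<n}" "a \<le> a'"
  shows "card {h. h < n \<and> \<alpha> h < a' \<and> P h} \<le> card {h. h < n \<and> \<alpha> h < a \<and> P h} + (a' - a)"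
proof -
  have "{h. h < n \<and> \<alpha> h < a' \<and> P h} \<subseteq> {h. h < n \<and> \<alpha> h < a \<and> P h} \<union> {h. \<alpha> h \<in> {a..<a'}}" by auto
  moreover have "{h. \<alpha> h \<in> {a..<a'}} = \<alpha> -` {a..<a'}" by auto
  moreover have "card (\<alpha> -` {a..<a'}) = a' - a" "finite (\<alpha> -` {a..<a'})"
    using permutes_bij[OF assms(1)] card_vimage_inj[of \<alpha> "{a..<a'}"]
      finite_vimageI[of "{a..<a'}" \<alpha>] by (auto simp: bij_def)
  ultimately have "card {h. h < n \<and> \<alpha> h < a' \<and> P h} \<le> card ({h. h < n \<and> \<alpha> h < a \<and> P h} \<union> \<alpha> -` {a..<a'})"
    by (intro card_mono) auto
  also have "\<dots> \<le> card {h. h < n \<and> \<alpha> h < a \<and> P h} + card (\<alpha> -` {a..<a'})" by (rule card_Un_le)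
  finally show ?thesis using \<open>card (\<alpha> -` {a..<a'}) = a' - a\<close> by simp
qed

lemma discrepancy_swap: "discrepancy n \<alpha> \<beta> a b = discrepancy n \<beta> \<alpha> b a"
proof -
  have "{h. h < n \<and> \<alpha> h < a \<and> \<beta> h < b} = {h. h < n \<and> \<beta> h < b \<and> \<alpha> h < a}" by auto
  then show ?thesis unfolding discrepancy_def by (simp add: mult.commute)
qed

text \<open>Both terms of the discrepancy grow by an amount between 0 and
  \<open>(a' - a) / n\<close>, so their difference moves by at most that much: the Lipschitz
  constant is 1, not 2.\<close>

lemma discrepancy_lipschitz_left:
  assumes "\<alpha> permutes {..<n}" "b \<le> n" "n > 0"
  shows "\<bar>discrepancy n \<alpha> \<beta> a b - discrepancy n \<alpha> \<beta> a' b\<bar> \<le> \<bar>real a - real a'\<bar> / real n"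
proof -
  have *: "\<bar>discrepancy n \<alpha> \<beta> a' b - discrepancy n \<alpha> \<beta> a b\<bar> \<le> (real a' - real a) / real n"
    if "a \<le> a'" for a a'
  proof -
    let ?c = "\<lambda>a. real (card {h. h < n \<and> \<alpha> h < a \<and> \<beta> h < b})"
    have "card {h. h < n \<and> \<alpha> h < a \<and> \<beta> h < b} \<le> card {h. h < n \<and> \<alpha> h < a' \<and> \<beta> h < b}"
      using that by (intro card_mono) auto
    then have 1: "?c a \<le> ?c a'" by simp
    have "?c a' \<le> real (card {h. h < n \<and> \<alpha> h < a \<and> \<beta> h < b} + (a' - a))"
      using card_less_permutes_diff[OF assms(1) that] by (simp only: of_nat_le_iff)
    then have 2: "?c a' \<le> ?c a + (real a' - real a)" using that by simp
    have 3: "0 \<le> (real a' - real a) * real b" using that by simp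
    have 4: "(real a' - real a) * real b \<le> (real a' - real a) * real n"
      using that assms(2) by (intro mult_left_mono) auto
    have eq: "discrepancy n \<alpha> \<beta> a' b - discrepancy n \<alpha> \<beta> a b
        = ((?c a' - ?c a) * real n - (real a' - real a) * real b) / (real n)\<^sup>2"
      unfolding discrepancy_def using assms(3) by (simp add: field_simps power2_eq_square)
    have 5: "0 \<le> (?c a' - ?c a) * real n" using 1 by simp
    have 6: "(?c a' - ?c a) * real n \<le> (real a' - real a) * real n"
      using 2 by (intro mult_right_mono) auto
    have "\<bar>(?c a' - ?c a) * real n - (real a' - real a) * real b\<bar> \<le> (real a' - real a) * real n"
      using 3 4 5 6 by linarith
    then have "\<bar>discrepancy n \<alpha> \<beta> a' b - discrepancy n \<alpha> \<beta> a b\<bar> \<le> (real a' - real a) * real n / (real n)\<^sup>2"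
      unfolding eq abs_divide by (simp add: divide_right_mono)
    then show ?thesis using assms(3) by (simp add: power2_eq_square)
  qed
  show ?thesis
  proof (cases "a \<le> a'")
    case True
    then show ?thesis using *[OF True] by (simp add: abs_minus_commute)
  next
    case False
    then show ?thesis using *[of a' a] by simp
  qed
qed

lemma discrepancy_lipschitz:
  assumes "\<alpha> permutes {..<n}" "\<beta> permutes {..<n}" "a' \<le> n" "b \<le> n" "n > 0"
  shows "\<bar>discrepancy n \<alpha> \<beta> a b - discrepancy n \<alpha> \<beta> a' b'\<bar>
    \<le> (\<bar>real a - real a'\<bar> + \<bar>real b - real b'\<bar>) / real n"
  using discrepancy_lipschitz_left[OF assms(1,4,5), of \<beta> a a']
    discrepancy_lipschitz_left[OF assms(2,3,5), of \<alpha> b b']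
  unfolding discrepancy_swap[of n \<beta> \<alpha>] add_divide_distrib by linarith

text \<open>If F - x y has absolute value \<delta> at one grid point, the Lipschitz bound keeps it
  at least \<delta> / 2 on a square window of side about \<delta> n / 4. That window alone
  contributes (\<delta> / 4)^2 (\<delta> / 2)^2 = \<delta>^4 / 64 to the mean square.\<close>

lemma discrepancy_le_mean_square:
  assumes "\<alpha> permutes {..<n}" "\<beta> permutes {..<n}" "a \<le> n" "b \<le> n" "n > 0"
  shows "(discrepancy n \<alpha> \<beta> a b) ^ 4 \<le> 64 * mean_square_discrepancy n \<alpha> \<beta>"
proof (cases "a = 0 \<or> b = 0")
  case True
  then have "discrepancy n \<alpha> \<beta> a b = 0" unfolding discrepancy_def by auto
  then show ?thesis using mean_square_discrepancy_nonneg by simp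
next
  case False
  define \<delta> where "\<delta> = \<bar>discrepancy n \<alpha> \<beta> a b\<bar>"
  \<comment> \<open>Comparison with the zero line \<open>a = 0\<close> gives \<delta> \<le> 1, which
    makes the windows fit into \<open>{1..n}\<close>.\<close>
  have "\<bar>discrepancy n \<alpha> \<beta> a b - discrepancy n \<alpha> \<beta> 0 b\<bar> \<le> \<bar>real a - real 0\<bar> / real n"
    by (rule discrepancy_lipschitz_left) (use assms in auto)
  moreover have "discrepancy n \<alpha> \<beta> 0 b = 0" unfolding discrepancy_def by simp
  moreover have "real a / real n \<le> 1" using assms by simp
  ultimately have \<delta>: "0 \<le> \<delta>" "\<delta> \<le> 1" unfolding \<delta>_def by auto
  \<comment> \<open>Moving by at most \<open>r\<close> in both directions changes the discrepancy by
    at most 2 r / n \<le> \<delta> / 2, and taking \<open>r + 1\<close> points per side makes up for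
    the rounding.\<close>
  define r where "r = nat \<lfloor>\<delta> * real n / 4\<rfloor>"
  have r: "real r \<le> \<delta> * real n / 4" "\<delta> * real n / 4 \<le> real r + 1"
    unfolding r_def using \<delta> by auto linarith
  have "\<delta> * real n \<le> 1 * real n" using \<delta> by (intro mult_right_mono) auto
  then have "4 * r \<le> n" using r(1) by linarith
  \<comment> \<open>The window extends downwards from \<open>a\<close> when there is room, otherwise
    upwards, which \<open>4 * r \<le> n\<close> permits.\<close>
  have window: "\<exists>X. X \<subseteq> {1..n} \<and> card X = r + 1 \<and> (\<forall>x\<in>X. \<bar>real a - real x\<bar> \<le> real r)"
    if "0 < a" "a \<le> n" for a
  proof (cases "r < a")
    case True
    then show ?thesis using that by (intro exI[of _ "{a - r..a}"]) auto
  next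
    case False
    then show ?thesis using that \<open>4 * r \<le> n\<close> by (intro exI[of _ "{a..a + r}"]) auto
  qed
  obtain X where X: "X \<subseteq> {1..n}" "card X = r + 1" "\<forall>x\<in>X. \<bar>real a - real x\<bar> \<le> real r"
    using window[of a] False assms by auto
  obtain Y where Y: "Y \<subseteq> {1..n}" "card Y = r + 1" "\<forall>y\<in>Y. \<bar>real b - real y\<bar> \<le> real r"
    using window[of b] False assms by auto
  have large: "(\<delta> / 2)\<^sup>2 \<le> (discrepancy n \<alpha> \<beta> x y)\<^sup>2" if "x \<in> X" "y \<in> Y" for x y
  proof -
    have "\<bar>discrepancy n \<alpha> \<beta> a b - discrepancy n \<alpha> \<beta> x y\<bar> \<le> (\<bar>real a - real x\<bar> + \<bar>real b - real y\<bar>) / real n"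
      by (rule discrepancy_lipschitz) (use assms that X Y in auto)
    also have "\<dots> \<le> (2 * (\<delta> * real n / 4)) / real n"
      using that X(3) Y(3) r(1) by (intro divide_right_mono) force+
    also have "\<dots> = \<delta> / 2" using assms(5) by simp
    finally have "\<delta> / 2 \<le> \<bar>discrepancy n \<alpha> \<beta> x y\<bar>" unfolding \<delta>_def by linarith
    then show ?thesis using \<delta>(1) by (metis abs_le_square_iff abs_of_nonneg divide_nonneg_nonneg zero_le_numeral)
  qed
  have "(\<delta> * real n / 4)\<^sup>2 * (\<delta> / 2)\<^sup>2 \<le> (real r + 1)\<^sup>2 * (\<delta> / 2)\<^sup>2"
    using r(2) \<delta> by (intro mult_right_mono power_mono) auto
  also have "\<dots> = (\<Sum>x\<in>X. \<Sum>y\<in>Y. (\<delta> / 2)\<^sup>2)"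
    using X(2) Y(2) by (simp add: power2_eq_square algebra_simps)
  also have "\<dots> \<le> (\<Sum>x\<in>X. \<Sum>y\<in>Y. (discrepancy n \<alpha> \<beta> x y)\<^sup>2)"
    using large by (intro sum_mono) auto
  also have "\<dots> \<le> (\<Sum>x\<in>X. \<Sum>y = 1..n. (discrepancy n \<alpha> \<beta> x y)\<^sup>2)"
    using Y(1) by (intro sum_mono sum_mono2) auto
  also have "\<dots> \<le> (\<Sum>x = 1..n. \<Sum>y = 1..n. (discrepancy n \<alpha> \<beta> x y)\<^sup>2)"
    using X(1) by (intro sum_mono2) (auto intro: sum_nonneg)
  also have "\<dots> = mean_square_discrepancy n \<alpha> \<beta> * (real n)\<^sup>2"
    unfolding mean_square_discrepancy_def using assms(5) by simp
  finally have "\<delta> ^ 4 / 64 * (real n)\<^sup>2 \<le> mean_square_discrepancy n \<alpha> \<beta> * (real n)\<^sup>2"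
    by (simp add: power2_eq_square power4_eq_xxxx field_simps)
  then have "\<delta> ^ 4 / 64 \<le> mean_square_discrepancy n \<alpha> \<beta>" using assms(5) by simp
  then show ?thesis unfolding \<delta>_def by (simp add: power_abs)
qed

section \<open>The mean square discrepancy and four-point patterns\<close>

lemma card_maps_4:
  fixes n :: nat
  shows "real (card {h \<in> {1..4::nat} \<rightarrow>\<^sub>E {..<n}. P (h 1) (h 2) (h 3) (h 4)}) =
     (\<Sum>i<n. \<Sum>j<n. \<Sum>k<n. \<Sum>l<n. of_bool (P i j k l))"
proof -
  have I: "{1..4::nat} = insert 1 (insert 2 (insert 3 (insert (4::nat) {})))" by auto
  have "real (card {h \<in> {1..4::nat} \<rightarrow>\<^sub>E {..<n}. P (h 1) (h 2) (h 3) (h 4)}) =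
      (\<Sum>h\<in>{1..4::nat} \<rightarrow>\<^sub>E {..<n}. of_bool (P (h 1) (h 2) (h 3) (h 4)))"
    using finite_maps[of 1 4 n] by (simp add: Int_def)
  also have "\<dots> = (\<Sum>i<n. \<Sum>j<n. \<Sum>k<n. \<Sum>l<n. of_bool (P i j k l))"
    unfolding I by (simp add: sum_PiE_insert)
  finally show ?thesis .
qed

lemma sum_less_Suc_mult: "(\<Sum>x<n. real x * (real x + 1)) = (real n - 1) * real n * (real n + 1) / 3"
  by (induction n) (auto simp: field_simps)

lemma sum_squares_upto: "(\<Sum>a = 1..n. (real a)\<^sup>2) = real n * (real n + 1) * (2 * real n + 1) / 6"
  by (induction n) (auto simp: field_simps power2_eq_square)

lemma sum_above:
  assumes "i \<le> n"
  shows "(\<Sum>a = 1..n. of_bool (i < a) * real a) = (real n * (real n + 1) - real i * (real i + 1)) / 2"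
  using assms
proof (induction n rule: dec_induct)
  case base
  then show ?case by (auto intro!: sum.neutral)
next
  case (step m)
  then show ?case by (auto simp: field_simps)
qed

text \<open>The discrete form of the identity in the overview. It becomes an inequality because the
  square integrated against \<mu> is discarded and power sums are replaced by their leading terms,
  which costs at most \<open>1 / n\<close>.\<close>

lemma mean_square_discrepancy_le_peaks:
  assumes "\<alpha> permutes {..<n}" "\<beta> permutes {..<n}" "n > 0"
  shows "mean_square_discrepancy n \<alpha> \<beta> \<le>
     real (card {h \<in> {1..4::nat} \<rightarrow>\<^sub>E {..<n}. \<alpha> (h 3) \<le> \<alpha> (h 1) \<and> \<alpha> (h 4) \<le> \<alpha> (h 1) \<and>
         \<beta> (h 3) \<le> \<beta> (h 2) \<and> \<beta> (h 4) \<le> \<beta> (h 2)}) / real n ^ 4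
     + real (card (peak_maps n \<alpha> \<beta> 1 2 3 1 2 3)) / real n ^ 4 / 2
     - real (card (peak_maps n \<alpha> \<beta> 1 2 3 1 2 4)) / real n ^ 4 - 1 / 18 + 1 / real n"
proof -
  let ?n = "real n"
  define c where "c a b = (\<Sum>h<n. of_bool (\<alpha> h < a) * of_bool (\<beta> h < b) :: real)" for a b
  define P1 where "P1 = real (card {h \<in> {1..4::nat} \<rightarrow>\<^sub>E {..<n}. \<alpha> (h 3) \<le> \<alpha> (h 1) \<and> \<alpha> (h 4) \<le> \<alpha> (h 1) \<and>
         \<beta> (h 3) \<le> \<beta> (h 2) \<and> \<beta> (h 4) \<le> \<beta> (h 2)})"
  define P2 where "P2 = real (card (peak_maps n \<alpha> \<beta> 1 2 3 1 2 3))"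
  define P3 where "P3 = real (card (peak_maps n \<alpha> \<beta> 1 2 3 1 2 4))"
  define Q where "Q = (\<Sum>a = 1..n. (real a)\<^sup>2)"
  define S1 where "S1 = (\<Sum>a = 1..n. \<Sum>b = 1..n. (c a b)\<^sup>2)"
  define S2 where "S2 = (\<Sum>a = 1..n. \<Sum>b = 1..n. c a b * (real a * real b))"
  have perm: "(\<Sum>h<n. f (\<gamma> h)) = (\<Sum>x<n. f x)" if "\<gamma> permutes {..<n}" for f :: "nat \<Rightarrow> real" and \<gamma>
    using sum.permute[OF that, of f] by (simp add: comp_def)
  have shift: "(\<Sum>a = 1..n. f a) = (\<Sum>x<n. f (Suc x))" for f :: "nat \<Rightarrow> real"
    by (rule sum.reindex_bij_witness[where i = Suc and j = "\<lambda>a. a - 1"]) auto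
  have c_eq: "real (card {h. h < n \<and> \<alpha> h < a \<and> \<beta> h < b}) = c a b" for a b
    unfolding c_def by (simp add: Int_def flip: of_bool_conj)
  have c_count: "real x = (\<Sum>h<n. of_bool (\<gamma> h < x))" if "x < n" "\<gamma> permutes {..<n}" for \<gamma> x
  proof -
    have "(\<Sum>h<n. of_bool (\<gamma> h < x)) = (\<Sum>y<n. of_bool (y < x) :: real)"
      using perm[OF that(2), of "\<lambda>y. of_bool (y < x)"] .
    also have "\<dots> = real (card ({..<n} \<inter> {y. y < x}))" by simp
    also have "{..<n} \<inter> {y. y < x} = {..<x}" using that(1) by auto
    finally show ?thesis by simp
  qed
  have in_n: "\<alpha> h < n" "\<beta> h < n" if "h < n" for h
    using that permutes_in_image[OF assms(1), of h] permutes_in_image[OF assms(2), of h] by auto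

  have S1: "S1 = P1"
  proof -
    have "S1 = (\<Sum>x<n. \<Sum>y<n. (c (Suc x) (Suc y))\<^sup>2)" unfolding S1_def shift ..
    \<comment> \<open>A uniform grid point is made of the abscissa of \<open>i\<close> and the
      ordinate of an independent \<open>j\<close>. As grid lines are counted from 1, the comparison
      \<open>< Suc x\<close> becomes the nonstrict one of the first event.\<close>
    also have "\<dots> = (\<Sum>i<n. \<Sum>j<n. (c (Suc (\<alpha> i)) (Suc (\<beta> j)))\<^sup>2)"
      using perm[OF assms(1), of "\<lambda>x. \<Sum>y<n. (c (Suc x) (Suc y))\<^sup>2"]
        perm[OF assms(2), of "\<lambda>y. (c (Suc (\<alpha> _)) (Suc y))\<^sup>2"] by simp
    also have "\<dots> = (\<Sum>i<n. \<Sum>j<n. \<Sum>k<n. \<Sum>l<n. of_bool (\<alpha> k \<le> \<alpha> i \<and> \<alpha> l \<le> \<alpha> i \<and> \<beta> k \<le> \<beta> j \<and> \<beta> l \<le> \<beta> j))"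
      unfolding c_def power2_eq_square sum_product
      by (intro sum.cong refl) (auto simp: less_Suc_eq_le)
    finally show ?thesis
      using card_maps_4[of n "\<lambda>i j k l. \<alpha> k \<le> \<alpha> i \<and> \<alpha> l \<le> \<alpha> i \<and> \<beta> k \<le> \<beta> j \<and> \<beta> l \<le> \<beta> j"]
      unfolding P1_def by simp
  qed

  \<comment> \<open>Fubini: for each point \<open>h\<close> the sums over
    \<open>a > \<alpha> h\<close> and \<open>b > \<beta> h\<close> separate. Both carry a factor 1/2
    by \<open>sum_above\<close>, which the 4 clears.\<close>
  have S2: "4 * S2 = (\<Sum>h<n. (?n * (?n + 1) - real (\<alpha> h) * (real (\<alpha> h) + 1)) *
      (?n * (?n + 1) - real (\<beta> h) * (real (\<beta> h) + 1)))"
  proof -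
    have "S2 = (\<Sum>a = 1..n. \<Sum>b = 1..n. \<Sum>h<n. (of_bool (\<alpha> h < a) * real a) * (of_bool (\<beta> h < b) * real b))"
      unfolding S2_def c_def sum_distrib_right by (intro sum.cong refl) simp
    also have "\<dots> = (\<Sum>a = 1..n. \<Sum>h<n. \<Sum>b = 1..n. (of_bool (\<alpha> h < a) * real a) * (of_bool (\<beta> h < b) * real b))"
      by (intro sum.cong refl sum.swap)
    also have "\<dots> = (\<Sum>h<n. \<Sum>a = 1..n. \<Sum>b = 1..n. (of_bool (\<alpha> h < a) * real a) * (of_bool (\<beta> h < b) * real b))"
      by (rule sum.swap)
    also have "\<dots> = (\<Sum>h<n. (\<Sum>a = 1..n. of_bool (\<alpha> h < a) * real a) * (\<Sum>b = 1..n. of_bool (\<beta> h < b) * real b))"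
      unfolding sum_product ..
    also have "\<dots> = (\<Sum>h<n. ((?n * (?n + 1) - real (\<alpha> h) * (real (\<alpha> h) + 1)) / 2) *
      ((?n * (?n + 1) - real (\<beta> h) * (real (\<beta> h) + 1)) / 2))"
      using in_n by (intro sum.cong refl arg_cong2[of _ _ _ _ "(*)"] sum_above) (auto intro: less_imp_le)
    finally show ?thesis by (simp add: sum_distrib_left)
  qed

  define A where "A h = real (\<alpha> h) * (real (\<alpha> h) + 1)" for h
  define B where "B h = real (\<beta> h) * (real (\<beta> h) + 1)" for h
  define N where "N = ?n * (?n + 1)"
  have sumA: "(\<Sum>h<n. A h) = (?n - 1) * ?n * (?n + 1) / 3"
    unfolding A_def using perm[OF assms(1), of "\<lambda>x. real x * (real x + 1)"] sum_less_Suc_mult by simp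
  have sumB: "(\<Sum>h<n. B h) = (?n - 1) * ?n * (?n + 1) / 3"
    unfolding B_def using perm[OF assms(2), of "\<lambda>x. real x * (real x + 1)"] sum_less_Suc_mult by simp
  have "4 * S2 = (\<Sum>h<n. N\<^sup>2 - N * A h - N * B h + A h * B h)"
    unfolding S2 A_def[symmetric] B_def[symmetric] N_def[symmetric]
    by (intro sum.cong refl) (simp add: algebra_simps power2_eq_square)
  also have "\<dots> = ?n * N\<^sup>2 - N * (\<Sum>h<n. A h) - N * (\<Sum>h<n. B h) + (\<Sum>h<n. A h * B h)"
    by (simp add: sum.distrib sum_subtractf sum_distrib_left)
  also have "\<dots> = ?n\<^sup>2 * (?n + 1)\<^sup>2 * (?n + 2) / 3 + (\<Sum>h<n. A h * B h)"
    unfolding sumA sumB N_def by (simp add: field_simps power2_eq_square)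
  finally have S2': "4 * S2 = ?n\<^sup>2 * (?n + 1)\<^sup>2 * (?n + 2) / 3 + (\<Sum>h<n. A h * B h)" .
  \<comment> \<open>\<open>S2\<close> enters the mean square with a negative sign, so a lower bound
    is enough and the lower-order terms may go.\<close>
  have "?n\<^sup>2 * ?n\<^sup>2 * ?n \<le> ?n\<^sup>2 * (?n + 1)\<^sup>2 * (?n + 2)"
    by (intro mult_mono power_mono) auto
  then have n5: "?n ^ 5 / 3 \<le> ?n\<^sup>2 * (?n + 1)\<^sup>2 * (?n + 2) / 3"
    by (simp add: power2_eq_square eval_nat_numeral mult_ac)

  define k where "k h = c (\<alpha> h) (\<beta> h)" for h
  \<comment> \<open>Nonnegativity of the square integrated against \<mu>: it trades the five-point
    quantity \<open>A h * B h\<close> for the three-point and four-point ones that become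
    \<open>P2\<close> and \<open>P3\<close>.\<close>
  have AB: "2 * ?n * (k h * real (\<alpha> h) * real (\<beta> h)) - ?n\<^sup>2 * (k h)\<^sup>2 \<le> A h * B h" for h
  proof -
    have "0 \<le> (?n * k h - real (\<alpha> h) * real (\<beta> h))\<^sup>2" by simp
    then have "2 * ?n * (k h * real (\<alpha> h) * real (\<beta> h)) - ?n\<^sup>2 * (k h)\<^sup>2
        \<le> (real (\<alpha> h) * real (\<alpha> h)) * (real (\<beta> h) * real (\<beta> h))"
      by (simp add: power2_diff power2_eq_square algebra_simps)
    also have "\<dots> \<le> A h * B h" unfolding A_def B_def by (intro mult_mono) auto
    finally show ?thesis .
  qed
  have P2: "P2 = ?n * (\<Sum>h<n. (k h)\<^sup>2)"
  proof -
    have "P2 = (\<Sum>i<n. \<Sum>j<n. \<Sum>k<n. \<Sum>l<n. of_bool (\<alpha> j < \<alpha> i \<and> \<alpha> k < \<alpha> i \<and> \<beta> j < \<beta> i \<and> \<beta> k < \<beta> i))"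
      using card_maps_4[of n "\<lambda>i j k l. \<alpha> j < \<alpha> i \<and> \<alpha> k < \<alpha> i \<and> \<beta> j < \<beta> i \<and> \<beta> k < \<beta> i"]
      unfolding P2_def peak_maps_def by simp
    also have "\<dots> = (\<Sum>i<n. \<Sum>j<n. \<Sum>k<n. ?n *
        (of_bool (\<alpha> j < \<alpha> i) * of_bool (\<beta> j < \<beta> i) * (of_bool (\<alpha> k < \<alpha> i) * of_bool (\<beta> k < \<beta> i))))"
      by (intro sum.cong refl) auto
    also have "\<dots> = ?n * (\<Sum>h<n. (k h)\<^sup>2)"
      unfolding k_def c_def power2_eq_square sum_product by (simp only: sum_distrib_left)
    finally show ?thesis .
  qed
  have P3: "P3 = (\<Sum>h<n. k h * real (\<alpha> h) * real (\<beta> h))"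
  proof -
    have "P3 = (\<Sum>i<n. \<Sum>j<n. \<Sum>k<n. \<Sum>l<n. of_bool (\<alpha> j < \<alpha> i \<and> \<alpha> k < \<alpha> i \<and> \<beta> j < \<beta> i \<and> \<beta> l < \<beta> i))"
      using card_maps_4[of n "\<lambda>i j k l. \<alpha> j < \<alpha> i \<and> \<alpha> k < \<alpha> i \<and> \<beta> j < \<beta> i \<and> \<beta> l < \<beta> i"]
      unfolding P3_def peak_maps_def by simp
    also have "\<dots> = (\<Sum>i<n. \<Sum>j<n. \<Sum>k<n. \<Sum>l<n.
        (of_bool (\<alpha> j < \<alpha> i) * of_bool (\<beta> j < \<beta> i)) * (of_bool (\<alpha> k < \<alpha> i) * of_bool (\<beta> l < \<beta> i)))"
      by (intro sum.cong refl) auto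
    also have "\<dots> = (\<Sum>i<n. k i * ((\<Sum>k<n. of_bool (\<alpha> k < \<alpha> i)) * (\<Sum>l<n. of_bool (\<beta> l < \<beta> i))))"
      unfolding k_def c_def sum_product by (simp only: sum_distrib_left)
    also have "\<dots> = (\<Sum>h<n. k h * real (\<alpha> h) * real (\<beta> h))"
      using c_count[OF in_n(1) assms(1)] c_count[OF in_n(2) assms(2)] by (intro sum.cong refl) simp
    finally show ?thesis .
  qed
  have "2 * ?n * P3 - ?n * P2 = (\<Sum>h<n. 2 * ?n * (k h * real (\<alpha> h) * real (\<beta> h)) - ?n\<^sup>2 * (k h)\<^sup>2)"
    unfolding P2 P3 by (simp add: sum_subtractf sum_distrib_left power2_eq_square mult_ac)
  also have "\<dots> \<le> (\<Sum>h<n. A h * B h)" by (intro sum_mono AB)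
  finally have S2_ge: "?n ^ 5 / 3 + 2 * ?n * P3 - ?n * P2 \<le> 4 * S2" using S2' n5 by linarith

  have Q: "Q\<^sup>2 \<le> ?n ^ 6 * (1 / 9 + 1 / ?n)"
  proof -
    \<comment> \<open>The lower coefficients 12 + 13 + 6 + 1 = 32 are rounded up to 36, so that
      division by 36 leaves exactly \<open>1 / 9 + 1 / n\<close>.\<close>
    have "((?n + 1) * (2 * ?n + 1))\<^sup>2 = 4 * ?n ^ 4 + 12 * ?n ^ 3 + 13 * ?n\<^sup>2 + 6 * ?n + 1"
      by (simp add: eval_nat_numeral algebra_simps)
    moreover have "1 \<le> ?n ^ 3" "?n \<le> ?n ^ 3" "?n\<^sup>2 \<le> ?n ^ 3"
      using assms(3) power_increasing[of 0 3 ?n] power_increasing[of 1 3 ?n] power_increasing[of 2 3 ?n] by auto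
    ultimately have "((?n + 1) * (2 * ?n + 1))\<^sup>2 \<le> 4 * ?n ^ 4 + 36 * ?n ^ 3" by linarith
    then have "?n\<^sup>2 * ((?n + 1) * (2 * ?n + 1))\<^sup>2 / 36 \<le> ?n\<^sup>2 * (4 * ?n ^ 4 + 36 * ?n ^ 3) / 36"
      by (intro divide_right_mono mult_left_mono) auto
    moreover have "Q\<^sup>2 = ?n\<^sup>2 * ((?n + 1) * (2 * ?n + 1))\<^sup>2 / 36"
      unfolding Q_def sum_squares_upto by (simp add: power_mult_distrib power_divide)
    moreover have "?n\<^sup>2 * (4 * ?n ^ 4 + 36 * ?n ^ 3) / 36 = ?n ^ 6 * (1 / 9 + 1 / ?n)"
      using assms(3) by (simp add: eval_nat_numeral field_simps)
    ultimately show ?thesis by (simp only:)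
  qed

  have square: "(x / ?n - y * z / ?n\<^sup>2)\<^sup>2 = x\<^sup>2 / ?n\<^sup>2 - 2 / ?n ^ 3 * (x * (y * z)) + y\<^sup>2 * z\<^sup>2 / ?n ^ 4"
    for x y z using assms(3) by (simp add: field_simps eval_nat_numeral)
  have "mean_square_discrepancy n \<alpha> \<beta> =
      (\<Sum>a = 1..n. \<Sum>b = 1..n. (c a b)\<^sup>2 / ?n\<^sup>2 - 2 / ?n ^ 3 * (c a b * (real a * real b))
        + (real a)\<^sup>2 * (real b)\<^sup>2 / ?n ^ 4) / ?n\<^sup>2"
    unfolding mean_square_discrepancy_def discrepancy_def c_eq square ..
  also have "\<dots> = (S1 / ?n\<^sup>2 - 2 / ?n ^ 3 * S2 + Q * Q / ?n ^ 4) / ?n\<^sup>2"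
    unfolding S1_def S2_def Q_def sum_product
    by (simp add: sum.distrib sum_subtractf sum_distrib_left sum_divide_distrib)
  also have "\<dots> = P1 / ?n ^ 4 - 4 * S2 / (2 * ?n ^ 5) + Q\<^sup>2 / ?n ^ 6"
    unfolding S1 using assms(3) by (simp add: eval_nat_numeral field_simps)
  \<comment> \<open>The constants are 1/9 from \<open>Q\<close> and -1/6 from the term
    \<open>n ^ 5 / 3\<close>, together -1/18.\<close>
  also have "\<dots> \<le> P1 / ?n ^ 4 - (?n ^ 5 / 3 + 2 * ?n * P3 - ?n * P2) / (2 * ?n ^ 5)
      + (?n ^ 6 * (1 / 9 + 1 / ?n)) / ?n ^ 6"
    using S2_ge Q by (intro add_mono diff_mono divide_right_mono) auto
  also have "\<dots> = P1 / ?n ^ 4 + P2 / ?n ^ 4 / 2 - P3 / ?n ^ 4 - 1 / 18 + 1 / ?n"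
    using assms(3) by (simp add: eval_nat_numeral field_simps)
  finally show ?thesis unfolding P1_def P2_def P3_def .
qed

text \<open>The first quotient is \<kappa> times the second, where \<kappa> is the probability that
  four uniform indices are distinct. The second is a probability, so the difference is at most 1 -
  \<kappa>, and the birthday bound gives 16 = 4 * 4.\<close>

lemma inj_peak_maps_density:
  assumes "\<alpha> permutes {..<n}" "\<beta> permutes {..<n}" "n \<ge> 4" "{a, b, c, a', b', c'} \<subseteq> {1..4}"
  shows "\<bar>real (card {h \<in> peak_maps n \<alpha> \<beta> a b c a' b' c'. inj_on h {1..4}}) / real n ^ 4 -
     (\<Sum>\<pi>\<in>peak_perms a b c. \<Sum>\<rho>\<in>peak_perms a' b' c'. pattern_density n \<alpha> \<beta> 4 (inv \<pi> \<circ> \<rho>)) / 24\<bar>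
     \<le> 16 / real n"
proof -
  define J where "J = card {h \<in> peak_maps n \<alpha> \<beta> a b c a' b' c'. inj_on h {1..4}}"
  define R where "R = (\<Sum>\<pi>\<in>peak_perms a b c. \<Sum>\<rho>\<in>peak_perms a' b' c'. pattern_density n \<alpha> \<beta> 4 (inv \<pi> \<circ> \<rho>))"
  define \<kappa> where "\<kappa> = fact 4 * real (n choose 4) / real n ^ 4"
  have C: "0 < real (n choose 4)" using assms(3) by simp
  have R: "R = real J / real (n choose 4)"
    unfolding R_def J_def card_inj_peak_maps[OF assms(1,2,4)] pattern_density_def
    by (simp flip: sum_divide_distrib)
  have "J \<le> card {h \<in> {1..4} \<rightarrow>\<^sub>E {..<n}. inj_on h {1..4::nat}}"
    unfolding J_def peak_maps_def by (intro card_mono) (auto intro: finite_subset[OF _ finite_maps[of 1 4 n]])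
  then have "real J \<le> real (fact 4 * (n choose 4))" unfolding card_injections of_nat_le_iff .
  then have "R \<le> 24" unfolding R using C by (simp add: fact_numeral divide_le_eq)
  have "0 \<le> R" unfolding R by simp
  have "1 - 16 / real n \<le> \<kappa>"
    using injections_almost_all[of n 4] assms(3) unfolding \<kappa>_def by simp
  have "real ((n choose 4) * fact 4) \<le> real (n ^ 4)" using binomial_fact_pow of_nat_le_iff by blast
  then have "\<kappa> \<le> 1" unfolding \<kappa>_def using assms(3) by (simp add: mult.commute divide_le_eq)
  have "real J / real n ^ 4 = \<kappa> * (R / 24)"
    unfolding R \<kappa>_def using C by (simp add: fact_numeral)
  then have "\<bar>real J / real n ^ 4 - R / 24\<bar> = (1 - \<kappa>) * (R / 24)"
    using \<open>\<kappa> \<le> 1\<close> \<open>0 \<le> R\<close> mult_right_mono[of \<kappa> 1 "R / 24"] by (simp add: left_diff_distrib)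
  also have "\<dots> \<le> (1 - \<kappa>) * 1"
    using \<open>\<kappa> \<le> 1\<close> \<open>R \<le> 24\<close> by (intro mult_left_mono) auto
  also have "\<dots> \<le> 16 / real n" using \<open>1 - 16 / real n \<le> \<kappa>\<close> by simp
  finally show ?thesis unfolding J_def R_def .
qed

lemma card_maps_le_inj:
  fixes P :: "(nat \<Rightarrow> nat) \<Rightarrow> bool"
  assumes "n > 0"
  shows "real (card {h \<in> {1..4} \<rightarrow>\<^sub>E {..<n}. P h}) / real n ^ 4
    \<le> real (card {h \<in> {1..4} \<rightarrow>\<^sub>E {..<n}. P h \<and> inj_on h {1..4}}) / real n ^ 4 + 16 / real n"
proof -
  let ?H = "{1..4::nat} \<rightarrow>\<^sub>E {..<n}"
  have "card {h \<in> ?H. P h} \<le> card ({h \<in> ?H. P h \<and> inj_on h {1..4}} \<union> (?H - {h \<in> ?H. inj_on h {1..4}}))"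
    by (intro card_mono) auto
  also have "\<dots> \<le> card {h \<in> ?H. P h \<and> inj_on h {1..4}} + card (?H - {h \<in> ?H. inj_on h {1..4}})"
    by (rule card_Un_le)
  finally have 1: "card {h \<in> ?H. P h} \<le> card {h \<in> ?H. P h \<and> inj_on h {1..4}} + card (?H - {h \<in> ?H. inj_on h {1..4}})" .
  have "card (?H - {h \<in> ?H. inj_on h {1..4}}) = card ?H - card {h \<in> ?H. inj_on h {1..4}}"
    by (rule card_Diff_subset) (auto intro: finite_subset[OF _ finite_maps[of 1 4 n]])
  also have "\<dots> = n ^ 4 - fact 4 * (n choose 4)"
    unfolding card_injections by (simp add: card_PiE)
  finally have 2: "real (card (?H - {h \<in> ?H. inj_on h {1..4}})) = real n ^ 4 - fact 4 * real (n choose 4)"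
    using binomial_fact_pow[of n 4] by (simp add: mult.commute)
  have "real (card {h \<in> ?H. P h}) / real n ^ 4
     \<le> (real (card {h \<in> ?H. P h \<and> inj_on h {1..4}}) + (real n ^ 4 - fact 4 * real (n choose 4))) / real n ^ 4"
    using 1 unfolding 2[symmetric] by (intro divide_right_mono) (simp_all flip: of_nat_add)
  also have "\<dots> = real (card {h \<in> ?H. P h \<and> inj_on h {1..4}}) / real n ^ 4 + (1 - fact 4 * real (n choose 4) / real n ^ 4)"
    using assms by (simp add: add_divide_distrib diff_divide_distrib)
  also have "\<dots> \<le> real (card {h \<in> ?H. P h \<and> inj_on h {1..4}}) / real n ^ 4 + 16 / real n"
    using injections_almost_all[of n 4] assms by simp
  finally show ?thesis .
qed

text \<open>Linearity in the densities is what allows passing to expectations for random graphs.\<close>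

lemma mean_square_discrepancy_le_linear:
  obtains c :: "(nat \<Rightarrow> nat) \<Rightarrow> real" where
    "\<And>n \<alpha> \<beta>. \<alpha> permutes {..<n} \<Longrightarrow> \<beta> permutes {..<n} \<Longrightarrow> n \<ge> 4 \<Longrightarrow>
      mean_square_discrepancy n \<alpha> \<beta> \<le>
        (\<Sum>\<tau> | \<tau> permutes {1..4}. c \<tau> * (pattern_density n \<alpha> \<beta> 4 \<tau> - 1 / 24)) + 65 / real n"
proof -
  \<comment> \<open>The number of ways to write \<tau> as \<open>inv \<pi> \<circ> \<rho>\<close>.
    It depends on the event only, so the final coefficients serve all \<open>n\<close>, \<alpha> and
    \<beta>.\<close>
  define m where "m a b c a' b' c' \<tau> =
    real (card {p \<in> peak_perms a b c \<times> peak_perms a' b' c'. inv (fst p) \<circ> snd p = \<tau>})"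
    for a b c a' b' c' \<tau>
  \<comment> \<open>There are 8 * 8 = 64 pairs, so centring every density at 1/24 costs 64 / 24 = 8
    / 3.\<close>
  have group: "(\<Sum>\<pi>\<in>peak_perms a b c. \<Sum>\<rho>\<in>peak_perms a' b' c'. f (inv \<pi> \<circ> \<rho>)) =
      (\<Sum>\<tau> | \<tau> permutes {1..4}. m a b c a' b' c' \<tau> * (f \<tau> - 1 / 24)) + 8 / 3"
    if "{a, b, c, a', b', c'} \<subseteq> {1..4}" "distinct [a, b, c]" "distinct [a', b', c']"
    for a b c a' b' c' and f :: "(nat \<Rightarrow> nat) \<Rightarrow> real"
  proof -
    let ?P = "peak_perms a b c \<times> peak_perms a' b' c'"
    have "(\<Sum>\<tau> | \<tau> permutes {1..4}. m a b c a' b' c' \<tau> * (f \<tau> - 1 / 24)) =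
      (\<Sum>\<tau>\<in>{\<tau>. \<tau> permutes {1..4}}. \<Sum>p\<in>{p \<in> ?P. inv (fst p) \<circ> snd p = \<tau>}. f (inv (fst p) \<circ> snd p) - 1 / 24)"
      unfolding m_def by (intro sum.cong refl) simp
    also have "\<dots> = (\<Sum>p\<in>?P. f (inv (fst p) \<circ> snd p) - 1 / 24)"
    proof (rule sum.group)
      show "(\<lambda>p. inv (fst p) \<circ> snd p) ` ?P \<subseteq> {\<tau>. \<tau> permutes {1..4}}"
        by (auto simp: peak_perms_def intro!: permutes_compose permutes_inv)
    qed (auto simp: finite_peak_perms finite_permutations)
    also have "\<dots> = (\<Sum>p\<in>?P. f (inv (fst p) \<circ> snd p)) - real (card ?P) / 24"
      by (simp add: sum_subtractf)
    also have "card ?P = 64"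
      using that card_peak_perms[of a b c] card_peak_perms[of a' b' c'] by (simp add: card_cartesian_product)
    finally show ?thesis by (simp add: sum.cartesian_product case_prod_beta comp_def)
  qed
  define c where "c \<tau> = (m 1 3 4 2 3 4 \<tau> + m 1 2 3 1 2 3 \<tau> / 2 - m 1 2 3 1 2 4 \<tau>) / 24" for \<tau>
  show ?thesis
  proof (rule that)
    fix n \<alpha> \<beta> assume \<alpha>: "\<alpha> permutes {..<n}" and \<beta>: "\<beta> permutes {..<n}" and n: "n \<ge> (4::nat)"
    let ?d = "\<lambda>\<tau>. pattern_density n \<alpha> \<beta> 4 \<tau>"
    let ?H = "{1..4::nat} \<rightarrow>\<^sub>E {..<n}"
    define L where "L a b c a' b' c' = (\<Sum>\<tau> | \<tau> permutes {1..4}. m a b c a' b' c' \<tau> * (?d \<tau> - 1 / 24))"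
      for a b c a' b' c'
    define J where "J a b c a' b' c' = real (card {h \<in> peak_maps n \<alpha> \<beta> a b c a' b' c'. inj_on h {1..4}}) / real n ^ 4"
      for a b c a' b' c'
    have J: "\<bar>J a b c a' b' c' - (L a b c a' b' c' + 8 / 3) / 24\<bar> \<le> 16 / real n"
      if "{a, b, c, a', b', c'} \<subseteq> {1..4}" "distinct [a, b, c]" "distinct [a', b', c']" for a b c a' b' c'
      using inj_peak_maps_density[OF \<alpha> \<beta> n that(1)] unfolding group[OF that] J_def L_def .
    \<comment> \<open>Injective maps have no ties, which turns the nonstrict event of the Riemann
      sum into the peak event \<open>1 3 4 2 3 4\<close>.\<close>
    have strict: "\<gamma> (h p) \<le> \<gamma> (h q) \<longleftrightarrow> \<gamma> (h p) < \<gamma> (h q)"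
      if "\<gamma> permutes {..<n}" "inj_on h {1..4}" "p \<in> {1..4}" "q \<in> {1..4}" "p \<noteq> q" for \<gamma> h :: "nat \<Rightarrow> nat" and p q
    proof -
      have "h p \<noteq> h q" using inj_onD[OF that(2)] that(3-5) by blast
      then have "\<gamma> (h p) \<noteq> \<gamma> (h q)" using permutes_inj[OF that(1)] by (simp add: inj_eq)
      then show ?thesis by (simp add: less_le)
    qed
    have "{h \<in> ?H. (\<alpha> (h 3) \<le> \<alpha> (h 1) \<and> \<alpha> (h 4) \<le> \<alpha> (h 1) \<and> \<beta> (h 3) \<le> \<beta> (h 2) \<and> \<beta> (h 4) \<le> \<beta> (h 2)) \<and> inj_on h {1..4}}
        = {h \<in> peak_maps n \<alpha> \<beta> 1 3 4 2 3 4. inj_on h {1..4}}"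
    proof (rule Collect_cong)
      fix h
      show "(h \<in> ?H \<and> (\<alpha> (h 3) \<le> \<alpha> (h 1) \<and> \<alpha> (h 4) \<le> \<alpha> (h 1) \<and> \<beta> (h 3) \<le> \<beta> (h 2) \<and> \<beta> (h 4) \<le> \<beta> (h 2)) \<and> inj_on h {1..4})
        \<longleftrightarrow> (h \<in> peak_maps n \<alpha> \<beta> 1 3 4 2 3 4 \<and> inj_on h {1..4})"
      proof (cases "inj_on h {1..4}")
        case True
        note st = strict[OF \<alpha> True] strict[OF \<beta> True]
        show ?thesis unfolding peak_maps_def mem_Collect_eq
          using st(1)[of 3 1] st(1)[of 4 1] st(2)[of 3 2] st(2)[of 4 2] by simp
      qed simp
    qed
    then have 1: "real (card {h \<in> ?H. \<alpha> (h 3) \<le> \<alpha> (h 1) \<and> \<alpha> (h 4) \<le> \<alpha> (h 1) \<and> \<beta> (h 3) \<le> \<beta> (h 2) \<and> \<beta> (h 4) \<le> \<beta> (h 2)}) / real n ^ 4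
        \<le> J 1 3 4 2 3 4 + 16 / real n"
      using card_maps_le_inj[of n "\<lambda>h. \<alpha> (h 3) \<le> \<alpha> (h 1) \<and> \<alpha> (h 4) \<le> \<alpha> (h 1) \<and> \<beta> (h 3) \<le> \<beta> (h 2) \<and> \<beta> (h 4) \<le> \<beta> (h 2)"] n
      unfolding J_def by simp
    have 2: "real (card (peak_maps n \<alpha> \<beta> 1 2 3 1 2 3)) / real n ^ 4 \<le> J 1 2 3 1 2 3 + 16 / real n"
      using card_maps_le_inj[of n "\<lambda>h. \<alpha> (h 2) < \<alpha> (h 1) \<and> \<alpha> (h 3) < \<alpha> (h 1) \<and> \<beta> (h 2) < \<beta> (h 1) \<and> \<beta> (h 3) < \<beta> (h 1)"] n
      unfolding J_def peak_maps_def by simp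
    have "card {h \<in> peak_maps n \<alpha> \<beta> 1 2 3 1 2 4. inj_on h {1..4}} \<le> card (peak_maps n \<alpha> \<beta> 1 2 3 1 2 4)"
      unfolding peak_maps_def by (intro card_mono) (auto intro: finite_subset[OF _ finite_maps[of 1 4 n]])
    then have 3: "J 1 2 3 1 2 4 \<le> real (card (peak_maps n \<alpha> \<beta> 1 2 3 1 2 4)) / real n ^ 4"
      unfolding J_def by (intro divide_right_mono) auto
    have combine: "x \<le> j1 + j2 / 2 - j3 - u + w"
      if "x \<le> p1 + p2 / 2 - p3 - u + w" "p1 \<le> j1" "p2 \<le> j2" "j3 \<le> p3"
      for x p1 p2 p3 j1 j2 j3 u w :: real using that by linarith
    \<comment> \<open>The constants cancel: each event has the centre (8 / 3) / 24 = 1/9, and 1/9 +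
      1/18 - 1/9 - 1/18 = 0. The errors add up to 32 + 16 + 16 + 1 = 65 multiples of
      \<open>1 / w\<close>.\<close>
    have linear: "(j1 + 16 / w) + (j2 + 16 / w) / 2 - j3 - 1 / 18 + 1 / w \<le> (l1 + l2 / 2 - l3) / 24 + 65 * (1 / w)"
      if "\<bar>j1 - (l1 + 8 / 3) / 24\<bar> \<le> 16 / w" "\<bar>j2 - (l2 + 8 / 3) / 24\<bar> \<le> 16 / w"
        "\<bar>j3 - (l3 + 8 / 3) / 24\<bar> \<le> 16 / w"
      for j1 j2 j3 l1 l2 l3 w :: real
    proof -
      define v where "v = 1 / w"
      have v: "16 / w = 16 * v" "1 / w = v" unfolding v_def by auto
      show ?thesis using that unfolding v by (simp add: abs_le_iff field_simps)
    qed
    have "n > 0" using n by simp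
    have "mean_square_discrepancy n \<alpha> \<beta> \<le> (J 1 3 4 2 3 4 + 16 / real n) + (J 1 2 3 1 2 3 + 16 / real n) / 2
        - J 1 2 3 1 2 4 - 1 / 18 + 1 / real n"
      by (rule combine[OF mean_square_discrepancy_le_peaks[OF \<alpha> \<beta> \<open>n > 0\<close>] 1 2 3])
    also have "\<dots> \<le> (L 1 3 4 2 3 4 + L 1 2 3 1 2 3 / 2 - L 1 2 3 1 2 4) / 24 + 65 * (1 / real n)"
      by (rule linear) (use J[of 1 3 4 2 3 4] J[of 1 2 3 1 2 3] J[of 1 2 3 1 2 4] in simp_all)
    also have "(L 1 3 4 2 3 4 + L 1 2 3 1 2 3 / 2 - L 1 2 3 1 2 4) / 24 = (\<Sum>\<tau> | \<tau> permutes {1..4}. c \<tau> * (?d \<tau> - 1 / 24))"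
      unfolding L_def c_def sum_divide_distrib sum.distrib[symmetric] sum_subtractf[symmetric]
      by (intro sum.cong refl) (simp add: field_simps)
    finally show "mean_square_discrepancy n \<alpha> \<beta> \<le>
        (\<Sum>\<tau> | \<tau> permutes {1..4}. c \<tau> * (?d \<tau> - 1 / 24)) + 65 / real n" by simp
  qed
qed

text \<open>Dividing the estimate for counts by \<open>r = (n choose s) / n ^ s\<close> compares the
  density with \<open>r\<close>; the price is at most \<open>s ^ s\<close> because
  \<open>(n / s) ^ s \<le> n choose s\<close>. Moreover \<open>fact s * r\<close> is the probability
  that \<open>s\<close> uniform indices are distinct, which puts \<open>r\<close> close to
  \<open>1 / fact s\<close>.\<close>

lemma pattern_density_near_uniform:
  assumes "\<alpha> permutes {..<n}" "\<beta> permutes {..<n}" "\<sigma> permutes {1..s}" "n > 0" "s \<le> n"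
    and "\<And>a b. a \<le> n \<Longrightarrow> b \<le> n \<Longrightarrow> \<bar>discrepancy n \<alpha> \<beta> a b\<bar> \<le> \<delta>"
  shows "\<bar>pattern_density n \<alpha> \<beta> s \<sigma> - 1 / fact s\<bar> \<le> real s ^ s * (4 * real s * \<delta>) + real s * real s / real n"
proof -
  define r where "r = real (n choose s) / real n ^ s"
  have "0 \<le> \<delta>" using assms(6)[of 0 0] by simp
  have C: "0 < real (n choose s)" using assms(5) by simp
  then have "0 < r" unfolding r_def using assms(4) by simp
  have "(real n / real s) ^ s \<le> real (n choose s)"
    using binomial_ge_n_over_k_pow_k[OF assms(5), where ?'a = real] .
  then have "1 / r \<le> real s ^ s"
  proof (cases "s = 0")
    case False
    have "real n ^ s \<le> real (n choose s) * real s ^ s"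
      using \<open>(real n / real s) ^ s \<le> _\<close> False by (simp add: power_divide divide_le_eq)
    then show ?thesis unfolding r_def using C by (simp add: divide_le_eq mult.commute)
  qed (simp add: r_def)
  have "real (pattern_count n \<alpha> \<beta> s \<sigma>) / real n ^ s - r\<^sup>2 = r * (pattern_density n \<alpha> \<beta> s \<sigma> - r)"
    unfolding pattern_density_def r_def using C by (simp add: power2_eq_square algebra_simps)
  moreover have "\<bar>real (pattern_count n \<alpha> \<beta> s \<sigma>) / real n ^ s - r\<^sup>2\<bar> \<le> 4 * real s * \<delta>"
    unfolding r_def by (rule pattern_count_near_product[OF assms(1-4,6)])
  ultimately have "r * \<bar>pattern_density n \<alpha> \<beta> s \<sigma> - r\<bar> \<le> 4 * real s * \<delta>"
    using \<open>0 < r\<close> by (simp add: abs_mult)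
  then have "\<bar>pattern_density n \<alpha> \<beta> s \<sigma> - r\<bar> \<le> (1 / r) * (4 * real s * \<delta>)"
    using \<open>0 < r\<close> by (simp add: pos_le_divide_eq mult.commute)
  also have "\<dots> \<le> real s ^ s * (4 * real s * \<delta>)"
    using \<open>1 / r \<le> real s ^ s\<close> \<open>0 \<le> \<delta>\<close> by (intro mult_right_mono) auto
  finally have 1: "\<bar>pattern_density n \<alpha> \<beta> s \<sigma> - r\<bar> \<le> real s ^ s * (4 * real s * \<delta>)" .
  have "real ((n choose s) * fact s) \<le> real (n ^ s)" using binomial_fact_pow of_nat_le_iff by blast
  then have up: "fact s * r \<le> 1" unfolding r_def using assms(4) by (simp add: mult.commute divide_le_eq)
  have low: "1 - real s * real s / real n \<le> fact s * r"
    using injections_almost_all[OF assms(4), of s] unfolding r_def by simp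
  have "\<bar>r - 1 / fact s\<bar> = (1 - fact s * r) / fact s"
    using up by (simp add: field_simps abs_if)
  also have "\<dots> \<le> (1 - fact s * r) / 1"
    using up by (intro divide_left_mono) auto
  also have "\<dots> \<le> real s * real s / real n" using low by simp
  finally show ?thesis using 1 by linarith
qed

text \<open>The discrepancy is bounded by a fourth root of the mean square, which is not linear. The
  inequality t \<le> \<eta> + t^4 / \<eta>^3 makes it so, at the price of an arbitrarily small
  additive constant and of coefficients that depend on \<epsilon>.\<close>

lemma pattern_density_le_linear:
  assumes "\<epsilon> > (0::real)"
  obtains c :: "(nat \<Rightarrow> nat) \<Rightarrow> real" and K :: real where
    "\<And>n \<alpha> \<beta> \<sigma>. \<alpha> permutes {..<n} \<Longrightarrow> \<beta> permutes {..<n} \<Longrightarrow> n \<ge> 4 \<Longrightarrow> n \<ge> s \<Longrightarrow> \<sigma> permutes {1..s} \<Longrightarrow>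
      \<bar>pattern_density n \<alpha> \<beta> s \<sigma> - 1 / fact s\<bar> \<le>
        \<epsilon> + (\<Sum>\<tau> | \<tau> permutes {1..4}. c \<tau> * (pattern_density n \<alpha> \<beta> 4 \<tau> - 1 / 24)) + K / real n"
proof -
  obtain c where c: "\<And>n \<alpha> \<beta>. \<alpha> permutes {..<n} \<Longrightarrow> \<beta> permutes {..<n} \<Longrightarrow> n \<ge> 4 \<Longrightarrow>
      mean_square_discrepancy n \<alpha> \<beta> \<le>
        (\<Sum>\<tau> | \<tau> permutes {1..4}. c \<tau> * (pattern_density n \<alpha> \<beta> 4 \<tau> - 1 / 24)) + 65 / real n"
    using mean_square_discrepancy_le_linear by blast
  \<comment> \<open>The summand 1 keeps \<open>M\<close> positive for \<open>s = 0\<close>; \<eta>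
    is then scaled so that \<open>M * \<eta> = \<epsilon>\<close>.\<close>
  define M where "M = real s ^ s * (4 * real s) + 1"
  have "M > 0" unfolding M_def by (simp add: add_nonneg_pos)
  define \<eta> where "\<eta> = \<epsilon> / M"
  have "\<eta> > 0" unfolding \<eta>_def using assms \<open>M > 0\<close> by simp
  define B where "B = M * 64 / \<eta> ^ 3"
  have "B \<ge> 0" unfolding B_def using \<open>M > 0\<close> \<open>\<eta> > 0\<close> by simp
  show ?thesis
  proof (rule that)
    fix n \<alpha> \<beta> \<sigma>
    assume \<alpha>: "\<alpha> permutes {..<n}" and \<beta>: "\<beta> permutes {..<n}" and n: "n \<ge> (4::nat)" "n \<ge> s"
      and \<sigma>: "\<sigma> permutes {1..s}"
    define D where "D = mean_square_discrepancy n \<alpha> \<beta>"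
    have "D \<ge> 0" unfolding D_def by (rule mean_square_discrepancy_nonneg)
    have "\<bar>discrepancy n \<alpha> \<beta> a b\<bar> \<le> \<eta> + 64 * D / \<eta> ^ 3" if "a \<le> n" "b \<le> n" for a b
    proof (cases "\<bar>discrepancy n \<alpha> \<beta> a b\<bar> \<le> \<eta>")
      case True
      then show ?thesis using \<open>D \<ge> 0\<close> \<open>\<eta> > 0\<close> by (simp add: add_increasing2)
    next
      case False
      let ?g = "\<bar>discrepancy n \<alpha> \<beta> a b\<bar>"
      have "?g * \<eta> ^ 3 \<le> ?g * ?g ^ 3"
        using False \<open>\<eta> > 0\<close> by (intro mult_left_mono power_mono) auto
      also have "\<dots> = (discrepancy n \<alpha> \<beta> a b) ^ 4"
        by (simp add: eval_nat_numeral abs_mult)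
      also have "\<dots> \<le> 64 * D"
        unfolding D_def using discrepancy_le_mean_square[OF \<alpha> \<beta> that] n by simp
      finally have "?g \<le> 64 * D / \<eta> ^ 3" using \<open>\<eta> > 0\<close> by (simp add: pos_le_divide_eq)
      then show ?thesis using \<open>\<eta> > 0\<close> by simp
    qed
    then have "\<bar>pattern_density n \<alpha> \<beta> s \<sigma> - 1 / fact s\<bar> \<le>
        real s ^ s * (4 * real s * (\<eta> + 64 * D / \<eta> ^ 3)) + real s * real s / real n"
      using n by (intro pattern_density_near_uniform[OF \<alpha> \<beta> \<sigma>]) auto
    also have "real s ^ s * (4 * real s * (\<eta> + 64 * D / \<eta> ^ 3)) \<le> M * (\<eta> + 64 * D / \<eta> ^ 3)"
      unfolding M_def mult.assoc[symmetric] using \<open>D \<ge> 0\<close> \<open>\<eta> > 0\<close> by (intro mult_right_mono) auto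
    also have "\<dots> = \<epsilon> + B * D"
      unfolding B_def \<eta>_def using \<open>M > 0\<close> by (simp add: algebra_simps)
    also have "B * D \<le> B * ((\<Sum>\<tau> | \<tau> permutes {1..4}. c \<tau> * (pattern_density n \<alpha> \<beta> 4 \<tau> - 1 / 24)) + 65 / real n)"
      unfolding D_def using c[OF \<alpha> \<beta> n(1)] \<open>B \<ge> 0\<close> by (intro mult_left_mono)
    finally show "\<bar>pattern_density n \<alpha> \<beta> s \<sigma> - 1 / fact s\<bar> \<le>
        \<epsilon> + (\<Sum>\<tau> | \<tau> permutes {1..4}. B * c \<tau> * (pattern_density n \<alpha> \<beta> 4 \<tau> - 1 / 24))
        + (B * 65 + real s * real s) / real n"
      by (simp add: distrib_left sum_distrib_left add_divide_distrib mult.assoc)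
  qed
qed

section \<open>Random tie-breaking\<close>

text \<open>Total orders refining the weak order given by \<open>l\<close>, encoded as rank
  functions. One choice breaks the ties of all edges at once, whereas \<open>induced_perm\<close>
  breaks them anew in every sample; the lemmas below reconcile the two.\<close>

definition tie_breakings :: "nat \<Rightarrow> (nat \<Rightarrow> nat) \<Rightarrow> (nat \<Rightarrow> nat) set" where
  "tie_breakings n l = {\<alpha>. \<alpha> permutes {..<n} \<and> (\<forall>i<n. \<forall>j<n. l i < l j \<longrightarrow> \<alpha> i < \<alpha> j)}"

lemma finite_tie_breakings: "finite (tie_breakings n l)"
  unfolding tie_breakings_def by (rule finite_subset[OF _ finite_permutations[of "{..<n}"]]) auto

lemma tie_breakings_nonempty: "tie_breakings n l \<noteq> {}"
proof -
  \<comment> \<open>A lexicographic code of endpoint and edge index, injective because the index is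
    below \<open>n\<close>. The shift by one fits the range \<open>{1..n}\<close> of
    \<open>sorting_perm_exists\<close>.\<close>
  define v where "v t = l (t - 1) * n + (t - 1)" for t
  have v_less: "v (Suc i) < v (Suc j)" if "l i < l j" "i < n" for i j
  proof -
    have "l i * n + i < l i * n + n" using that by simp
    also have "\<dots> = Suc (l i) * n" by simp
    also have "\<dots> \<le> l j * n" using that by (intro mult_right_mono) auto
    finally show ?thesis unfolding v_def by simp
  qed
  have "inj_on v {1..n}"
  proof (rule inj_onI)
    fix x y assume xy: "x \<in> {1..n}" "y \<in> {1..n}" "v x = v y"
    have "l (x - 1) = l (y - 1)"
      using v_less[of "x - 1" "y - 1"] v_less[of "y - 1" "x - 1"] xy by force
    then show "x = y" using xy unfolding v_def by auto
  qed
  then obtain \<pi> where \<pi>: "\<pi> permutes {1..n}" "strict_mono_on {1..n} (\<lambda>t. v (\<pi> t))"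
    by (rule sorting_perm_exists)
  define \<alpha> where "\<alpha> i = (if i < n then inv \<pi> (Suc i) - 1 else i)" for i
  have inv_in: "inv \<pi> (Suc i) \<in> {1..n}" if "i < n" for i
    using permutes_in_image[OF permutes_inv[OF \<pi>(1)], of "Suc i"] that by simp
  have "inj_on \<alpha> {..<n}"
  proof (rule inj_onI)
    fix i j assume ij: "i \<in> {..<n}" "j \<in> {..<n}" "\<alpha> i = \<alpha> j"
    then have "inv \<pi> (Suc i) = inv \<pi> (Suc j)"
      using inv_in[of i] inv_in[of j] unfolding \<alpha>_def by auto
    then show "i = j" using permutes_inj[OF permutes_inv[OF \<pi>(1)]] by (auto dest: injD)
  qed
  moreover have "\<alpha> ` {..<n} \<subseteq> {..<n}"
  proof (rule image_subsetI)
    fix i assume "i \<in> {..<n}"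
    then show "\<alpha> i \<in> {..<n}" using inv_in[of i] unfolding \<alpha>_def by auto
  qed
  ultimately have "\<alpha> permutes {..<n}"
    by (intro bij_imp_permutes bij_betw_imageI endo_inj_surj) (auto simp: \<alpha>_def)
  moreover have "\<alpha> i < \<alpha> j" if "i < n" "j < n" "l i < l j" for i j
    using sorted_less_iff_inv_less[OF \<pi>, of "Suc i" "Suc j"] v_less[OF that(3,1)] that
      inv_in[of i] inv_in[of j]
    unfolding \<alpha>_def by auto
  ultimately show ?thesis unfolding tie_breakings_def by blast
qed

text \<open>The sorted list of a multiset of values is unique, even when ties let several
  permutations produce it.\<close>

lemma mono_on_rearrangement_unique:
  fixes v :: "nat \<Rightarrow> nat"
  assumes "\<sigma> permutes {1..s}" "\<tau> permutes {1..s}"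
    and "mono_on {1..s} (\<lambda>t. v (\<sigma> t))" "mono_on {1..s} (\<lambda>t. v (\<tau> t))" "t \<in> {1..s}"
  shows "v (\<sigma> t) = v (\<tau> t)"
proof -
  have s: "sorted (map (\<lambda>t. v (\<pi> t)) [1..<Suc s])" if "mono_on {1..s} (\<lambda>t. v (\<pi> t))" for \<pi>
    using that unfolding sorted_map sorted_wrt_iff_nth_less monotone_on_def by (auto simp del: upt_Suc)
  have m: "mset (map (\<lambda>t. v (\<pi> t)) [1..<Suc s]) = image_mset v (mset_set {1..s})"
    if "\<pi> permutes {1..s}" for \<pi>
  proof -
    have "mset (map (\<lambda>t. v (\<pi> t)) [1..<Suc s]) = image_mset v (image_mset \<pi> (mset_set {1..s}))"
      by (simp add: image_mset.compositionality comp_def atLeastLessThanSuc_atLeastAtMost del: upt_Suc flip: mset_set_upto_eq_mset_upto)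
    also have "image_mset \<pi> (mset_set {1..s}) = mset_set {1..s}"
      using permutes_image[OF that] permutes_inj_on[OF that] by (simp add: image_mset_mset_set)
    finally show ?thesis .
  qed
  have "map (\<lambda>t. v (\<sigma> t)) [1..<Suc s] = map (\<lambda>t. v (\<tau> t)) [1..<Suc s]"
    using properties_for_sort[OF _ s[OF assms(3)], of "map (\<lambda>t. v (\<tau> t)) [1..<Suc s]"]
      properties_for_sort[OF refl s[OF assms(4)]] m[OF assms(1)] m[OF assms(2)]
    by metis
  then show ?thesis using assms(5) by (simp del: upt_Suc)
qed

lemma tie_breaking_sorted:
  fixes e l :: "nat \<Rightarrow> nat" and s n :: nat
  assumes "\<alpha> \<in> tie_breakings n l" "\<And>t. t \<in> {1..s} \<Longrightarrow> e t < n"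
    and "strict_mono_on {1..s} (\<lambda>t. \<alpha> (e t))"
  shows "mono_on {1..s} (\<lambda>t. l (e t))"
proof (rule mono_onI)
  fix t u assume tu: "t \<in> {1..s}" "u \<in> {1..s}" "t \<le> u"
  show "l (e t) \<le> l (e u)"
  proof (rule ccontr)
    assume "\<not> l (e t) \<le> l (e u)"
    then have "\<alpha> (e u) < \<alpha> (e t)" "t \<noteq> u"
      using assms(1) assms(2)[OF tu(1)] assms(2)[OF tu(2)] unfolding tie_breakings_def by auto
    moreover have "\<alpha> (e t) < \<alpha> (e u)"
      using assms(3) tu \<open>t \<noteq> u\<close> unfolding monotone_on_def by simp
    ultimately show False by simp
  qed
qed

text \<open>Sorting along any tie-breaking gives such a permutation. It makes the sets under
  \<open>pmf_of_set\<close> in \<open>induced_perm\<close> nonempty, so that these distributions are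
  really uniform.\<close>

lemma mono_rearrangement_exists:
  fixes e l :: "nat \<Rightarrow> nat" and s n :: nat
  assumes "inj_on e {1..s}" "e ` {1..s} \<subseteq> {..<n}"
  shows "{\<sigma>. \<sigma> permutes {1..s} \<and> mono_on {1..s} (\<lambda>t. l (e (\<sigma> t)))} \<noteq> {}"
proof -
  obtain \<alpha> where \<alpha>: "\<alpha> \<in> tie_breakings n l" using tie_breakings_nonempty by blast
  then have "\<alpha> permutes {..<n}" unfolding tie_breakings_def by blast
  then have "inj_on (\<lambda>t. \<alpha> (e t)) {1..s}" using assms(1) by (simp only: inj_on_comp_permutes_maps)
  then obtain \<sigma> where \<sigma>: "\<sigma> permutes {1..s}" "strict_mono_on {1..s} (\<lambda>t. \<alpha> (e (\<sigma> t)))"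
    by (rule sorting_perm_exists)
  have "mono_on {1..s} (\<lambda>t. l (e (\<sigma> t)))"
    using tie_breaking_sorted[OF \<alpha> _ \<sigma>(2)] assms(2) permutes_in_image[OF \<sigma>(1)] by blast
  then show ?thesis using \<sigma>(1) by blast
qed

text \<open>Exchanging tied edges is a symmetry of \<open>tie_breakings\<close>, so all sorted
  arrangements of a sample come from equally many tie-breakings. Hence one global random
  tie-breaking acts on each sample like a local one.\<close>

lemma card_tie_breakings_sorted:
  fixes e l :: "nat \<Rightarrow> nat" and s n :: nat
  assumes e: "inj_on e {1..s}" "e ` {1..s} \<subseteq> {..<n}" and \<sigma>: "\<sigma> permutes {1..s}"
  shows "real (card {\<alpha> \<in> tie_breakings n l. strict_mono_on {1..s} (\<lambda>t. \<alpha> (e (\<sigma> t)))}) =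
    of_bool (mono_on {1..s} (\<lambda>t. l (e (\<sigma> t)))) * real (card (tie_breakings n l))
      / real (card {\<rho>. \<rho> permutes {1..s} \<and> mono_on {1..s} (\<lambda>t. l (e (\<rho> t)))})"
proof -
  let ?I = "{1..s}" and ?T = "tie_breakings n l"
  let ?S = "{\<rho>. \<rho> permutes ?I \<and> mono_on ?I (\<lambda>t. l (e (\<rho> t)))}"
  let ?A = "\<lambda>\<rho>. {\<alpha> \<in> ?T. strict_mono_on ?I (\<lambda>t. \<alpha> (e (\<rho> t)))}"
  have e_less: "e (\<rho> t) < n" if "\<rho> permutes ?I" "t \<in> ?I" for \<rho> t
    using that e(2) permutes_in_image[OF that(1), of t] by blast
  have sorted: "mono_on ?I (\<lambda>t. l (e (\<rho> t)))" if "\<alpha> \<in> ?A \<rho>" "\<rho> permutes ?I" for \<alpha> \<rho>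
    using tie_breaking_sorted[of \<alpha> n l s "\<lambda>t. e (\<rho> t)"] that e_less[OF that(2)] by blast
  have le: "card (?A \<rho>) \<le> card (?A \<tau>)" if \<rho>: "\<rho> \<in> ?S" and \<tau>: "\<tau> \<in> ?S" for \<rho> \<tau>
  proof -
    \<comment> \<open>Moves the sampled edge \<open>e (\<tau> t)\<close> to
      \<open>e (\<rho> t)\<close> and fixes all other edges. Both listings show the same sequence of
      \<open>l\<close>-values, so only tied edges are exchanged and \<alpha> \<mapsto> \<alpha>
      \<circ> \<psi> preserves tie-breakings.\<close>
    define \<psi> where "\<psi> x = (if x \<in> e ` ?I then e ((\<rho> \<circ> inv \<tau>) (inv_into ?I e x)) else x)" for x
    have \<rho>\<tau>: "\<rho> \<circ> inv \<tau> permutes ?I" using \<rho> \<tau> by (auto intro: permutes_compose permutes_inv)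
    have "\<psi> permutes e ` ?I"
      unfolding \<psi>_def by (rule permutes_bij_inv_into[OF \<rho>\<tau>]) (use e in \<open>auto simp: bij_betw_def\<close>)
    then have \<psi>: "\<psi> permutes {..<n}" by (rule permutes_subset) (use e in auto)
    have \<psi>_e: "\<psi> (e (\<tau> t)) = e (\<rho> t)" if "t \<in> ?I" for t
    proof -
      have "\<tau> t \<in> ?I" using that \<tau> permutes_in_image[of \<tau> ?I t] by blast
      moreover have "inv \<tau> (\<tau> t) = t" using \<tau> by (auto simp: permutes_inverses)
      ultimately show ?thesis unfolding \<psi>_def using e(1) by auto
    qed
    have l_\<psi>: "l (\<psi> x) = l x" for x
    proof (cases "x \<in> e ` ?I")
      case True
      then obtain u where u: "u \<in> ?I" "x = e u" by blast
      have "u \<in> \<tau> ` ?I" using u \<tau> permutes_image[of \<tau> ?I] by blast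
      then obtain t where t: "t \<in> ?I" "x = e (\<tau> t)" using u by blast
      have "l (e (\<rho> t)) = l (e (\<tau> t))"
        using mono_on_rearrangement_unique[of \<rho> s \<tau> "\<lambda>t. l (e t)" t] \<rho> \<tau> t(1) by blast
      then show ?thesis using \<psi>_e[OF t(1)] t by simp
    next
      case False
      then show ?thesis unfolding \<psi>_def by simp
    qed
    show ?thesis
    proof (rule card_inj_on_le[where f = "\<lambda>\<alpha>. \<alpha> \<circ> \<psi>"])
      show "inj_on (\<lambda>\<alpha>. \<alpha> \<circ> \<psi>) (?A \<rho>)"
        using permutes_surj[OF \<psi>] by (intro inj_onI) (metis surj_fun_eq)
      show "(\<lambda>\<alpha>. \<alpha> \<circ> \<psi>) ` ?A \<rho> \<subseteq> ?A \<tau>"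
      proof (rule image_subsetI)
        fix \<alpha> assume \<alpha>: "\<alpha> \<in> ?A \<rho>"
        then have \<alpha>': "\<alpha> permutes {..<n}" "\<And>i j. i < n \<Longrightarrow> j < n \<Longrightarrow> l i < l j \<Longrightarrow> \<alpha> i < \<alpha> j"
          unfolding tie_breakings_def by auto
        have "\<psi> i < n \<longleftrightarrow> i < n" for i using permutes_in_image[OF \<psi>, of i] by simp
        then have "\<alpha> \<circ> \<psi> \<in> ?T"
          unfolding tie_breakings_def using permutes_compose[OF \<psi> \<alpha>'(1)] \<alpha>'(2) l_\<psi> by auto
        moreover have "strict_mono_on ?I (\<lambda>t. (\<alpha> \<circ> \<psi>) (e (\<tau> t)))"
          using \<alpha> \<psi>_e unfolding monotone_on_def by simp
        ultimately show "\<alpha> \<circ> \<psi> \<in> ?A \<tau>" by blast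
      qed
    qed (use finite_tie_breakings in auto)
  qed
  show ?thesis
  proof (cases "\<sigma> \<in> ?S")
    case True
    have "?T = (\<Union>\<rho>\<in>?S. ?A \<rho>)"
    proof (intro set_eqI iffI)
      fix \<alpha> assume \<alpha>: "\<alpha> \<in> ?T"
      then have "\<alpha> permutes {..<n}" unfolding tie_breakings_def by blast
      then have "inj_on (\<lambda>t. \<alpha> (e t)) ?I" using e(1) by (simp only: inj_on_comp_permutes_maps)
      then obtain \<rho> where \<rho>: "\<rho> permutes ?I" "strict_mono_on ?I (\<lambda>t. \<alpha> (e (\<rho> t)))"
        by (rule sorting_perm_exists)
      then have "\<alpha> \<in> ?A \<rho>" using \<alpha> by blast
      then show "\<alpha> \<in> (\<Union>\<rho>\<in>?S. ?A \<rho>)" using \<rho>(1) sorted by blast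
    qed blast
    then have "card ?T = card (\<Union>\<rho>\<in>?S. ?A \<rho>)" by simp
    also have "\<dots> = (\<Sum>\<rho>\<in>?S. card (?A \<rho>))"
    proof (intro card_UN_disjoint ballI impI)
      show "finite ?S" by (rule finite_subset[OF _ finite_permutations[of ?I]]) auto
      show "finite (?A \<rho>)" for \<rho> using finite_tie_breakings by auto
      fix \<rho> \<tau> assume "\<rho> \<in> ?S" "\<tau> \<in> ?S" "\<rho> \<noteq> \<tau>"
      then show "?A \<rho> \<inter> ?A \<tau> = {}"
        using sorting_perm_unique[of \<rho> s "\<lambda>t. _ (e t)" \<tau>] by blast
    qed
    also have "\<dots> = (\<Sum>\<rho>\<in>?S. card (?A \<sigma>))"
      using le True by (intro sum.cong refl antisym) blast+
    also have "\<dots> = card ?S * card (?A \<sigma>)" by simp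
    finally have "real (card ?T) = real (card ?S) * real (card (?A \<sigma>))" by simp
    moreover have "finite ?S" by (rule finite_subset[OF _ finite_permutations[of ?I]]) auto
    then have "card ?S \<noteq> 0" using True card_0_eq by blast
    ultimately show ?thesis using True by simp
  next
    case False
    then have "?A \<sigma> = {}" using sorted \<sigma> by blast
    then have "card (?A \<sigma>) = 0" by (simp only: card.empty)
    then show ?thesis using False \<sigma> by simp
  qed
qed

text \<open>Every listing of the sample is \<open>e \<circ> \<rho>\<close> for exactly one
  permutation \<rho>. This matches the normalisation in \<open>induced_perm\<close> with the one in
  \<open>card_tie_breakings_sorted\<close>.\<close>

lemma card_left_sorted_listings:
  assumes "e \<in> extensional {1..s}" "bij_betw e {1..s} A"
  shows "card (left_sorted_listings s g A) =
    card {\<rho>. \<rho> permutes {1..s} \<and> mono_on {1..s} (\<lambda>t. left_end g (e (\<rho> t)))}"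
proof -
  let ?I = "{1..s}"
  let ?S = "{\<rho>. \<rho> permutes ?I \<and> mono_on ?I (\<lambda>t. left_end g (e (\<rho> t)))}"
  have inj: "inj_on (\<lambda>\<rho>. e \<circ> \<rho>) ?S"
  proof (rule inj_onI)
    fix \<rho> \<tau> assume \<rho>\<tau>: "\<rho> \<in> ?S" "\<tau> \<in> ?S" "e \<circ> \<rho> = e \<circ> \<tau>"
    show "\<rho> = \<tau>"
    proof
      fix t
      show "\<rho> t = \<tau> t"
      proof (cases "t \<in> ?I")
        case True
        have "\<rho> t \<in> ?I" "\<tau> t \<in> ?I" 
          using \<rho>\<tau>(1,2) True permutes_in_image[of \<rho> ?I t] permutes_in_image[of \<tau> ?I t] by auto
        then show ?thesis
          using fun_cong[OF \<rho>\<tau>(3), of t] assms(2) unfolding bij_betw_def by (auto dest: inj_onD)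
      next
        case False
        then show ?thesis using \<rho>\<tau>(1,2) permutes_not_in[of \<rho> ?I t] permutes_not_in[of \<tau> ?I t] by auto
      qed
    qed
  qed
  have "(\<lambda>\<rho>. e \<circ> \<rho>) ` ?S = left_sorted_listings s g A"
  proof (intro set_eqI iffI)
    fix f assume "f \<in> (\<lambda>\<rho>. e \<circ> \<rho>) ` ?S"
    then obtain \<rho> where \<rho>: "\<rho> permutes ?I" "mono_on ?I (\<lambda>t. left_end g (e (\<rho> t)))" "f = e \<circ> \<rho>" by blast
    have "f \<in> extensional ?I"
      using assms(1) permutes_not_in[OF \<rho>(1)] unfolding \<rho>(3) extensional_def by simp
    moreover have "bij_betw f ?I A"
      unfolding \<rho>(3) by (rule bij_betw_trans[OF permutes_imp_bij[OF \<rho>(1)] assms(2)])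
    ultimately show "f \<in> left_sorted_listings s g A"
      using \<rho>(2) unfolding left_sorted_listings_def \<rho>(3) by simp
  next
    fix f assume f: "f \<in> left_sorted_listings s g A"
    define \<rho> where "\<rho> t = (if t \<in> ?I then inv_into ?I e (f t) else t)" for t
    have "bij_betw (inv_into ?I e \<circ> f) ?I ?I"
      using f bij_betw_trans[of f ?I A "inv_into ?I e" ?I] bij_betw_inv_into[OF assms(2)]
      unfolding left_sorted_listings_def by blast
    then have "bij_betw \<rho> ?I ?I" by (rule bij_betw_cong[THEN iffD1, rotated]) (simp add: \<rho>_def)
    then have \<rho>: "\<rho> permutes ?I" by (rule bij_imp_permutes) (auto simp: \<rho>_def)
    have e\<rho>: "e (\<rho> t) = f t" if "t \<in> ?I" for t
    proof -
      have "f t \<in> A" using f that unfolding left_sorted_listings_def by (auto dest: bij_betwE)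
      then show ?thesis using that assms(2) unfolding \<rho>_def by (simp add: bij_betw_inv_into_right)
    qed
    have "f = e \<circ> \<rho>"
    proof
      fix t
      show "f t = (e \<circ> \<rho>) t"
      proof (cases "t \<in> ?I")
        case False
        then show ?thesis
          using f assms(1) unfolding left_sorted_listings_def \<rho>_def extensional_def by auto
      qed (simp add: e\<rho>)
    qed
    moreover have "mono_on ?I (\<lambda>t. left_end g (e (\<rho> t)))"
      using f e\<rho> unfolding left_sorted_listings_def monotone_on_def by simp
    ultimately show "f \<in> (\<lambda>\<rho>. e \<circ> \<rho>) ` ?S" using \<rho> by blast
  qed
  then show ?thesis using card_image[OF inj] by simp
qed

text \<open>Local tie-breaking is replaced by independent global tie-breakings of the left and of
  the right ends. Each pair of these turns the edges into points with distinct coordinates, for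
  which the probability of \<sigma> is the pattern density.\<close>

lemma pmf_induced_perm:
  assumes "s \<le> card (edge_set g)" "\<sigma> permutes {1..s}"
  defines "n \<equiv> card (edge_set g)"
  defines "TL \<equiv> tie_breakings n (left_end g)" and "TR \<equiv> tie_breakings n (right_end g)"
  shows "pmf (induced_perm s g) \<sigma> =
    (\<Sum>\<alpha>\<in>TL. \<Sum>\<beta>\<in>TR. pattern_density n \<alpha> \<beta> s \<sigma>) / (real (card TL) * real (card TR))"
proof -
  let ?I = "{1..s}"
  let ?M = "\<lambda>l e. {\<rho>. \<rho> permutes ?I \<and> mono_on ?I (\<lambda>t. l (e (\<rho> t) :: nat) :: nat)}"
  let ?l = "left_end g" and ?r = "right_end g"
  let ?B = "\<lambda>A. {e \<in> extensional ?I. bij_betw e ?I A}"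
  let ?H = "?I \<rightarrow>\<^sub>E {..<n}"
  have E: "edge_set g = {..<n}" unfolding n_def edge_set_def by simp
  define NL where "NL e = real (card {\<alpha> \<in> TL. strict_mono_on ?I (\<lambda>t. \<alpha> (e t))})" for e
  define NR where "NR e = real (card {\<beta> \<in> TR. strict_mono_on ?I (\<lambda>t. \<beta> (e (\<sigma> t)))})" for e
  have TL: "finite TL" "TL \<noteq> {}" "real (card TL) \<noteq> 0"
    using finite_tie_breakings[of n ?l] tie_breakings_nonempty[of n ?l] unfolding TL_def by auto
  have TR: "finite TR" "TR \<noteq> {}" "real (card TR) \<noteq> 0"
    using finite_tie_breakings[of n ?r] tie_breakings_nonempty[of n ?r] unfolding TR_def by auto
  have samples: "edge_samples s g = {A. A \<subseteq> {..<n} \<and> card A = s}" unfolding edge_samples_def E ..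
  have fin_samples: "finite (edge_samples s g)" unfolding samples by simp
  have card_samples: "card (edge_samples s g) = n choose s"
    unfolding samples using n_subsets[of "{..<n}" s] by simp
  have "n choose s > 0" using assms(1) unfolding n_def by simp
  then have ne_samples: "edge_samples s g \<noteq> {}" using card_samples by auto
  have finM: "finite (?M l e)" for l e
    by (rule finite_subset[OF _ finite_permutations[of ?I]]) auto
  have sample: "pmf (bind_pmf (pmf_of_set (left_sorted_listings s g A)) (\<lambda>e. pmf_of_set (inducible_perms s g e))) \<sigma>
      = (\<Sum>e\<in>?B A. NL e / real (card TL) * (NR e / real (card TR)))" if A: "A \<in> edge_samples s g" for A
  proof -
    have "finite A" "card A = s" "A \<subseteq> {..<n}" using A unfolding samples by (auto intro: finite_subset)
    then obtain f0 where "bij_betw f0 ?I A" by (metis ex_bij_betw_nat_finite_1)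
    then have f: "restrict f0 ?I \<in> extensional ?I" "bij_betw (restrict f0 ?I) ?I A"
      using bij_betw_cong[of ?I "restrict f0 ?I" f0 A] by auto
    have inB: "inj_on e ?I" "e ` ?I \<subseteq> {..<n}" if "e \<in> ?B A" for e
      using that \<open>A \<subseteq> {..<n}\<close> by (auto simp: bij_betw_def)
    have NL: "NL e / real (card TL) = of_bool (mono_on ?I (\<lambda>t. ?l (e t))) / real (card (left_sorted_listings s g A))"
      if "e \<in> ?B A" for e
    proof -
      have "card (left_sorted_listings s g A) = card (?M ?l e)"
        using card_left_sorted_listings[of e s A g] that by blast
      then show ?thesis
        using card_tie_breakings_sorted[OF inB[OF that] permutes_id, of ?l] TL(3)
        unfolding NL_def TL_def by simp
    qed
    have NR: "NR e / real (card TR) = of_bool (mono_on ?I (\<lambda>t. ?r (e (\<sigma> t)))) / real (card (inducible_perms s g e))"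
      if "e \<in> ?B A" for e
      using card_tie_breakings_sorted[OF inB[OF that] assms(2), of ?r] TR(3)
      unfolding NR_def TR_def inducible_perms_def by simp
    have finB: "finite (?B A)"
    proof (rule finite_subset)
      show "?B A \<subseteq> ?H" using \<open>A \<subseteq> {..<n}\<close> unfolding PiE_def Pi_def bij_betw_def by blast
    qed simp
    have LL: "left_sorted_listings s g A = {e \<in> ?B A. mono_on ?I (\<lambda>t. ?l (e t))}"
      unfolding left_sorted_listings_def by blast
    have finL: "finite (left_sorted_listings s g A)"
      by (rule finite_subset[OF _ finB]) (auto simp: LL)
    have "?M ?l (restrict f0 ?I) \<noteq> {}"
      using mono_rearrangement_exists[of "restrict f0 ?I" s n ?l] inB[of "restrict f0 ?I"] f by blast
    then have "card (left_sorted_listings s g A) \<noteq> 0"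
      unfolding card_left_sorted_listings[OF f] using finM[of ?l "restrict f0 ?I"] by simp
    then have neL: "left_sorted_listings s g A \<noteq> {}" by auto
    have ind: "pmf (pmf_of_set (inducible_perms s g e)) \<sigma> = NR e / real (card TR)" if "e \<in> ?B A" for e
    proof -
      have "inducible_perms s g e \<noteq> {}" "finite (inducible_perms s g e)"
        using mono_rearrangement_exists[OF inB[OF that], of ?r] finM[of ?r e]
        unfolding inducible_perms_def by blast+
      moreover have "\<sigma> \<in> inducible_perms s g e \<longleftrightarrow> mono_on ?I (\<lambda>t. ?r (e (\<sigma> t)))"
        unfolding inducible_perms_def using assms(2) by simp
      ultimately show ?thesis unfolding NR[OF that] by (simp add: indicator_def)
    qed
    have "pmf (bind_pmf (pmf_of_set (left_sorted_listings s g A)) (\<lambda>e. pmf_of_set (inducible_perms s g e))) \<sigma>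
      = (\<Sum>e\<in>left_sorted_listings s g A. NR e / real (card TR)) / real (card (left_sorted_listings s g A))"
      unfolding pmf_bind_pmf_of_set[OF neL finL]
      by (intro arg_cong2[of _ _ _ _ "(/)"] sum.cong refl ind) (auto simp: LL)
    also have "\<dots> = (\<Sum>e\<in>?B A. of_bool (mono_on ?I (\<lambda>t. ?l (e t))) * (NR e / real (card TR))) / real (card (left_sorted_listings s g A))"
      unfolding LL sum.inter_filter[OF finB]
      by (intro arg_cong2[of _ _ _ _ "(/)"] sum.cong refl) simp
    also have "\<dots> = (\<Sum>e\<in>?B A. NL e / real (card TL) * (NR e / real (card TR)))"
      unfolding sum_divide_distrib by (intro sum.cong refl) (simp add: NL)
    finally show ?thesis .
  qed
  \<comment> \<open>Maps with repeated values contribute nothing, which lets the sum over listings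
    of samples be extended to all maps.\<close>
  have zero: "NL e = 0" if "\<not> inj_on e ?I" for e
  proof -
    have "\<not> strict_mono_on ?I (\<lambda>t. \<alpha> (e t))" if "\<alpha> \<in> TL" for \<alpha>
    proof -
      have "\<alpha> permutes {..<n}" using that unfolding TL_def tie_breakings_def by blast
      then show ?thesis
        using strict_mono_on_imp_inj_on \<open>\<not> inj_on e ?I\<close> inj_on_comp_permutes_maps by blast
    qed
    then have "{\<alpha> \<in> TL. strict_mono_on ?I (\<lambda>t. \<alpha> (e t))} = {}" by blast
    then show ?thesis unfolding NL_def by (simp only: card.empty of_nat_0)
  qed
  have "pmf (induced_perm s g) \<sigma> =
      (\<Sum>A\<in>edge_samples s g. \<Sum>e\<in>?B A. NL e / real (card TL) * (NR e / real (card TR))) / real (n choose s)"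
    unfolding induced_perm_def pmf_bind_pmf_of_set[OF ne_samples fin_samples] card_samples
    by (intro arg_cong2[of _ _ _ _ "(/)"] sum.cong refl sample)
  also have "(\<Sum>A\<in>edge_samples s g. \<Sum>e\<in>?B A. NL e / real (card TL) * (NR e / real (card TR))) =
     (\<Sum>A\<in>edge_samples s g. \<Sum>e\<in>{e \<in> {e \<in> ?H. inj_on e ?I}. e ` ?I = A}. NL e / real (card TL) * (NR e / real (card TR)))"
  proof (intro sum.cong refl)
    fix A assume "A \<in> edge_samples s g"
    then have "A \<subseteq> {..<n}" unfolding samples by blast
    then show "?B A = {e \<in> {e \<in> ?H. inj_on e ?I}. e ` ?I = A}"
      unfolding PiE_def Pi_def bij_betw_def by blast
  qed
  also have "\<dots> = (\<Sum>e\<in>{e \<in> ?H. inj_on e ?I}. NL e / real (card TL) * (NR e / real (card TR)))"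
    by (rule sum.group) (auto simp: fin_samples samples card_image)
  also have "\<dots> = (\<Sum>e\<in>?H. NL e / real (card TL) * (NR e / real (card TR)))"
    by (rule sum.mono_neutral_left) (auto simp: zero)
  also have "\<dots> = (\<Sum>e\<in>?H. NL e * NR e) / (real (card TL) * real (card TR))"
    by (simp add: sum_divide_distrib)
  also have "(\<Sum>e\<in>?H. NL e * NR e) = (\<Sum>e\<in>?H. \<Sum>\<alpha>\<in>TL. \<Sum>\<beta>\<in>TR.
      of_bool (strict_mono_on ?I (\<lambda>t. \<alpha> (e t))) * of_bool (strict_mono_on ?I (\<lambda>t. \<beta> (e (\<sigma> t)))))"
    unfolding NL_def NR_def sum_product[symmetric] using TL(1) TR(1) by (simp add: Int_def)
  also have "\<dots> = (\<Sum>\<alpha>\<in>TL. \<Sum>\<beta>\<in>TR. \<Sum>e\<in>?H.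
      of_bool (strict_mono_on ?I (\<lambda>t. \<alpha> (e t))) * of_bool (strict_mono_on ?I (\<lambda>t. \<beta> (e (\<sigma> t)))))"
    by (subst sum.swap, rule sum.cong[OF refl], rule sum.swap)
  also have "\<dots> = (\<Sum>\<alpha>\<in>TL. \<Sum>\<beta>\<in>TR. real (pattern_count n \<alpha> \<beta> s \<sigma>))"
    unfolding pattern_count_def using finite_maps[of 1 s n]
    by (intro sum.cong refl) (simp add: Int_def flip: of_bool_conj)
  finally show ?thesis
    unfolding pattern_density_def by (simp add: sum_divide_distrib mult.commute)
qed

section \<open>Convergence of the densities\<close>

text \<open>The deterministic bound is averaged over all pairs of tie-breakings: its right side is
  affine in the four-point densities and so commutes with averaging, and the triangle inequality
  handles the left side.\<close>

lemma induced_perm_le_linear: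
  assumes "\<epsilon> > (0::real)"
  obtains c :: "(nat \<Rightarrow> nat) \<Rightarrow> real" and K :: real where
    "\<And>g \<sigma>. card (edge_set g) \<ge> 4 \<Longrightarrow> card (edge_set g) \<ge> s \<Longrightarrow> \<sigma> permutes {1..s} \<Longrightarrow>
      \<bar>pmf (induced_perm s g) \<sigma> - 1 / fact s\<bar> \<le>
        \<epsilon> + (\<Sum>\<tau> | \<tau> permutes {1..4}. c \<tau> * (pmf (induced_perm 4 g) \<tau> - 1 / 24))
          + K / real (card (edge_set g))"
proof -
  obtain c K where cK: "\<And>n \<alpha> \<beta> \<sigma>. \<alpha> permutes {..<n} \<Longrightarrow> \<beta> permutes {..<n} \<Longrightarrow> n \<ge> 4 \<Longrightarrow> n \<ge> s \<Longrightarrow>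
      \<sigma> permutes {1..s} \<Longrightarrow> \<bar>pattern_density n \<alpha> \<beta> s \<sigma> - 1 / fact s\<bar> \<le>
        \<epsilon> + (\<Sum>\<tau> | \<tau> permutes {1..4}. c \<tau> * (pattern_density n \<alpha> \<beta> 4 \<tau> - 1 / 24)) + K / real n"
    using pattern_density_le_linear[OF assms, of s] by blast
  show ?thesis
  proof (rule that)
    fix g \<sigma> assume g: "card (edge_set g) \<ge> 4" "card (edge_set g) \<ge> s" and \<sigma>: "\<sigma> permutes {1..s}"
    define n where "n = card (edge_set g)"
    define W where "W = tie_breakings n (left_end g) \<times> tie_breakings n (right_end g)"
    define d where "d s \<sigma> w = pattern_density n (fst w) (snd w) s \<sigma>" for s \<sigma> w
    define m where "m = real (card W)"
    let ?P = "{\<tau>. \<tau> permutes {1..4::nat}}"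
    have "m > 0"
      unfolding m_def W_def using finite_tie_breakings tie_breakings_nonempty by (simp add: card_gt_0_iff)
    have pmf_eq: "pmf (induced_perm s g) \<sigma> = (\<Sum>w\<in>W. d s \<sigma> w) / m"
      if "s \<le> n" "\<sigma> permutes {1..s}" for s \<sigma>
      using pmf_induced_perm[of s g \<sigma>] that unfolding n_def W_def d_def m_def
      by (simp add: sum.cartesian_product case_prod_beta card_cartesian_product)
    have "pmf (induced_perm s g) \<sigma> - 1 / fact s = (\<Sum>w\<in>W. d s \<sigma> w - 1 / fact s) / m"
      using pmf_eq[of s \<sigma>] g \<sigma> \<open>m > 0\<close> unfolding n_def[symmetric]
      by (simp add: sum_subtractf m_def[symmetric] diff_divide_distrib)
    then have "\<bar>pmf (induced_perm s g) \<sigma> - 1 / fact s\<bar> = \<bar>\<Sum>w\<in>W. d s \<sigma> w - 1 / fact s\<bar> / m"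
      using \<open>m > 0\<close> by simp
    also have "\<dots> \<le> (\<Sum>w\<in>W. \<bar>d s \<sigma> w - 1 / fact s\<bar>) / m"
      using \<open>m > 0\<close> by (intro divide_right_mono sum_abs) auto
    also have "\<dots> \<le> (\<Sum>w\<in>W. \<epsilon> + (\<Sum>\<tau>\<in>?P. c \<tau> * (d 4 \<tau> w - 1 / 24)) + K / real n) / m"
    proof (intro divide_right_mono sum_mono)
      fix w assume "w \<in> W"
      then have "fst w permutes {..<n}" "snd w permutes {..<n}" unfolding W_def tie_breakings_def by auto
      then show "\<bar>d s \<sigma> w - 1 / fact s\<bar> \<le> \<epsilon> + (\<Sum>\<tau>\<in>?P. c \<tau> * (d 4 \<tau> w - 1 / 24)) + K / real n"
        unfolding d_def using g \<sigma> by (intro cK) (auto simp: n_def)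
    qed (use \<open>m > 0\<close> in auto)
    also have "(\<Sum>w\<in>W. \<epsilon> + (\<Sum>\<tau>\<in>?P. c \<tau> * (d 4 \<tau> w - 1 / 24)) + K / real n)
        = m * \<epsilon> + (\<Sum>w\<in>W. \<Sum>\<tau>\<in>?P. c \<tau> * (d 4 \<tau> w - 1 / 24)) + m * (K / real n)"
      by (simp add: sum.distrib m_def)
    also have "(\<Sum>w\<in>W. \<Sum>\<tau>\<in>?P. c \<tau> * (d 4 \<tau> w - 1 / 24)) = (\<Sum>\<tau>\<in>?P. \<Sum>w\<in>W. c \<tau> * (d 4 \<tau> w - 1 / 24))"
      by (rule sum.swap)
    also have "\<dots> = (\<Sum>\<tau>\<in>?P. m * (c \<tau> * (pmf (induced_perm 4 g) \<tau> - 1 / 24)))"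
    proof (rule sum.cong[OF refl])
      fix \<tau> assume "\<tau> \<in> ?P"
      then have "(\<Sum>w\<in>W. d 4 \<tau> w) = m * pmf (induced_perm 4 g) \<tau>"
        using pmf_eq[of 4 \<tau>] g \<open>m > 0\<close> unfolding n_def[symmetric] by simp
      then show "(\<Sum>w\<in>W. c \<tau> * (d 4 \<tau> w - 1 / 24)) = m * (c \<tau> * (pmf (induced_perm 4 g) \<tau> - 1 / 24))"
        by (simp add: sum_subtractf algebra_simps flip: sum_distrib_left m_def)
    qed
    also have "(m * \<epsilon> + (\<Sum>\<tau>\<in>?P. m * (c \<tau> * (pmf (induced_perm 4 g) \<tau> - 1 / 24))) + m * (K / real n)) / m
        = \<epsilon> + (\<Sum>\<tau>\<in>?P. c \<tau> * (pmf (induced_perm 4 g) \<tau> - 1 / 24)) + K / real n"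
      using \<open>m > 0\<close> by (simp add: add_divide_distrib flip: sum_distrib_left)
    finally show "\<bar>pmf (induced_perm s g) \<sigma> - 1 / fact s\<bar> \<le>
        \<epsilon> + (\<Sum>\<tau>\<in>?P. c \<tau> * (pmf (induced_perm 4 g) \<tau> - 1 / 24)) + K / real (card (edge_set g))"
      unfolding n_def .
  qed
qed

section \<open>Passing to expectations over random multigraphs\<close>

lemma integrable_pmf_family: "integrable (measure_pmf p) (\<lambda>g. pmf (f g) x)"
  by (rule measure_pmf.integrable_const_bound[where B = 1]) (auto simp: pmf_le_1)

lemma pmf_uniform_perm:
  assumes "\<sigma> permutes {1..s}"
  shows "pmf (pmf_of_set {\<tau>. \<tau> permutes {1..s}}) \<sigma> = 1 / fact s"
proof -
  have "{\<tau>. \<tau> permutes {1..s}} \<noteq> {}" using assms by blast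
  moreover have "finite {\<tau>. \<tau> permutes {1..s}}" by (simp add: finite_permutations)
  ultimately show ?thesis
    using assms card_permutations[of "{1..s}" s] by simp
qed

theorem theorem1:
  fixes G :: "nat \<Rightarrow> bip_multigraph pmf" and s :: nat
  assumes "\<And>k g. g \<in> set_pmf (G k) \<Longrightarrow> wf_bip_multigraph g"
    and "tends_to_infinity_in_prob G left_size"
    and "tends_to_infinity_in_prob G right_size"
    and "tends_to_infinity_in_prob G (\<lambda>g. card (edge_set g))"
    and "asymp_block_free 4 G"
    and "s \<ge> 2"
  shows "asymp_block_free s G"
  unfolding asymp_block_free_def
proof (intro allI impI)
  fix \<sigma> :: "nat \<Rightarrow> nat" assume \<sigma>: "\<sigma> permutes {1..s}"
  let ?P = "{\<tau>. \<tau> permutes {1..4::nat}}"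
  define q where "q k = pmf (bind_pmf (G k) (induced_perm s)) \<sigma>" for k
  define p where "p k \<tau> = pmf (bind_pmf (G k) (induced_perm 4)) \<tau>" for k \<tau>
  have p_lim: "(\<lambda>k. p k \<tau>) \<longlonglongrightarrow> 1 / 24" if "\<tau> \<in> ?P" for \<tau>
  proof -
    have \<tau>: "\<tau> permutes {1..4}" using that by simp
    have "(\<lambda>k. p k \<tau>) \<longlonglongrightarrow> pmf (pmf_of_set ?P) \<tau>"
      using assms(5) \<tau> unfolding asymp_block_free_def p_def by blast
    moreover have "fact 4 = (24 :: real)" by (simp add: fact_numeral)
    ultimately show ?thesis unfolding pmf_uniform_perm[OF \<tau>] by simp
  qed
  have "q \<longlonglongrightarrow> 1 / fact s"
  proof (rule tendstoI)
    fix r :: real assume "0 < r"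
    \<comment> \<open>One third each for the constant of the linear bound, for \<open>K / n\<close>,
      and for the slack in the limit.\<close>
    define \<epsilon> where "\<epsilon> = r / 3"
    have "\<epsilon> > 0" using \<open>0 < r\<close> unfolding \<epsilon>_def by simp
    obtain c K where cK: "\<And>g \<sigma>. card (edge_set g) \<ge> 4 \<Longrightarrow> card (edge_set g) \<ge> s \<Longrightarrow> \<sigma> permutes {1..s} \<Longrightarrow>
        \<bar>pmf (induced_perm s g) \<sigma> - 1 / fact s\<bar> \<le>
        \<epsilon> + (\<Sum>\<tau>\<in>?P. c \<tau> * (pmf (induced_perm 4 g) \<tau> - 1 / 24)) + K / real (card (edge_set g))"
      using induced_perm_le_linear[OF \<open>\<epsilon> > 0\<close>, of s] by blast
    obtain N0 :: nat where N0: "\<bar>K\<bar> / \<epsilon> < real N0" using reals_Archimedean2 by blast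
    define N where "N = max (max 4 s) N0"
    have N: "N \<ge> 4" "N \<ge> s" "\<bar>K\<bar> / \<epsilon> < real N" using N0 unfolding N_def by auto
    define big where "big = {g. N \<le> card (edge_set g)}"
    define M where "M = 1 + (\<Sum>\<tau>\<in>?P. \<bar>c \<tau>\<bar>)"
    define bound where "bound g = 2 * \<epsilon> + (\<Sum>\<tau>\<in>?P. c \<tau> * (pmf (induced_perm 4 g) \<tau> - 1 / 24))
        + M * (1 - indicator big g)" for g
    have pointwise: "\<bar>pmf (induced_perm s g) \<sigma> - 1 / fact s\<bar> \<le> bound g" for g
    proof (cases "g \<in> big")
      case True
      then have n: "N \<le> card (edge_set g)" unfolding big_def by simp
      have "\<bar>K\<bar> < \<epsilon> * real N" using N(3) \<open>\<epsilon> > 0\<close> by (simp add: divide_less_eq mult.commute)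
      also have "\<dots> \<le> \<epsilon> * real (card (edge_set g))" using n \<open>\<epsilon> > 0\<close> by (intro mult_left_mono) auto
      finally have "K / real (card (edge_set g)) \<le> \<epsilon>" using n N(1) by (simp add: divide_le_eq)
      then show ?thesis using cK[of g \<sigma>] n N \<sigma> True unfolding bound_def by simp
    next
      case False
      have "\<bar>\<Sum>\<tau>\<in>?P. c \<tau> * (pmf (induced_perm 4 g) \<tau> - 1 / 24)\<bar> \<le> (\<Sum>\<tau>\<in>?P. \<bar>c \<tau>\<bar> * 1)"
      proof (intro order.trans[OF sum_abs] sum_mono)
        fix \<tau>
        have "\<bar>pmf (induced_perm 4 g) \<tau> - 1 / 24\<bar> \<le> 1"
          using pmf_nonneg[of "induced_perm 4 g" \<tau>] pmf_le_1[of "induced_perm 4 g" \<tau>] by linarith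
        then show "\<bar>c \<tau> * (pmf (induced_perm 4 g) \<tau> - 1 / 24)\<bar> \<le> \<bar>c \<tau>\<bar> * 1"
          unfolding abs_mult by (intro mult_left_mono) auto
      qed
      moreover have "\<bar>pmf (induced_perm s g) \<sigma> - 1 / fact s\<bar> \<le> 1"
      proof -
        have "0 \<le> 1 / (fact s :: real)" "1 / (fact s :: real) \<le> 1" by auto
        then show ?thesis
          using pmf_nonneg[of "induced_perm s g" \<sigma>] pmf_le_1[of "induced_perm s g" \<sigma>] by linarith
      qed
      ultimately show ?thesis using False \<open>\<epsilon> > 0\<close> unfolding bound_def M_def by simp
    qed
    have int_big: "integrable (measure_pmf (G k)) (indicat_real big)" for k
      by (rule measure_pmf.integrable_const_bound[where B = 1]) (auto simp: indicator_def)
    have int_bound: "integrable (measure_pmf (G k)) bound" for k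
      unfolding bound_def
      by (intro Bochner_Integration.integrable_add Bochner_Integration.integrable_sum
          Bochner_Integration.integrable_mult_right Bochner_Integration.integrable_diff
          integrable_pmf_family int_big) auto
    \<comment> \<open>The expectation of the pointwise bound. By linearity each four-point term
      becomes an averaged probability \<open>p k \<tau>\<close>, the only quantity that the
      hypothesis of order 4 controls.\<close>
    have le: "\<bar>q k - 1 / fact s\<bar> \<le> 2 * \<epsilon> + (\<Sum>\<tau>\<in>?P. c \<tau> * (p k \<tau> - 1 / 24)) + M * (1 - measure_pmf.prob (G k) big)" for k
    proof -
      have "\<bar>q k - 1 / fact s\<bar> = \<bar>\<integral>g. (pmf (induced_perm s g) \<sigma> - 1 / fact s) \<partial>measure_pmf (G k)\<bar>"
        unfolding q_def pmf_bind
        by (subst Bochner_Integration.integral_diff) (auto simp: integrable_pmf_family)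
      also have "\<dots> \<le> (\<integral>g. \<bar>pmf (induced_perm s g) \<sigma> - 1 / fact s\<bar> \<partial>measure_pmf (G k))"
        using integral_norm_bound[of "measure_pmf (G k)" "\<lambda>g. pmf (induced_perm s g) \<sigma> - 1 / fact s"] by simp
      also have "\<dots> \<le> (\<integral>g. bound g \<partial>measure_pmf (G k))"
        by (intro integral_mono int_bound pointwise)
          (auto simp: integrable_pmf_family)
      also have "\<dots> = 2 * \<epsilon> + (\<Sum>\<tau>\<in>?P. c \<tau> * (p k \<tau> - 1 / 24)) + M * (1 - measure_pmf.prob (G k) big)"
        unfolding bound_def p_def pmf_bind
        by (simp add: integrable_pmf_family int_big)
      finally show ?thesis .
    qed
    have "(\<lambda>k. 2 * \<epsilon> + (\<Sum>\<tau>\<in>?P. c \<tau> * (p k \<tau> - 1 / 24)) + M * (1 - measure_pmf.prob (G k) big))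
        \<longlonglongrightarrow> 2 * \<epsilon> + (\<Sum>\<tau>\<in>?P. c \<tau> * (1 / 24 - 1 / 24)) + M * (1 - 1)"
      using assms(4) unfolding tends_to_infinity_in_prob_def big_def
      by (intro tendsto_intros p_lim) auto
    then have "(\<lambda>k. 2 * \<epsilon> + (\<Sum>\<tau>\<in>?P. c \<tau> * (p k \<tau> - 1 / 24)) + M * (1 - measure_pmf.prob (G k) big))
        \<longlonglongrightarrow> 2 * \<epsilon>" by simp
    then have "eventually (\<lambda>k. 2 * \<epsilon> + (\<Sum>\<tau>\<in>?P. c \<tau> * (p k \<tau> - 1 / 24)) + M * (1 - measure_pmf.prob (G k) big) < 3 * \<epsilon>) sequentially"
      by (rule order_tendstoD) (use \<open>\<epsilon> > 0\<close> in simp)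
    then show "eventually (\<lambda>k. dist (q k) (1 / fact s) < r) sequentially"
    proof (rule eventually_mono)
      fix k
      assume "2 * \<epsilon> + (\<Sum>\<tau>\<in>?P. c \<tau> * (p k \<tau> - 1 / 24)) + M * (1 - measure_pmf.prob (G k) big) < 3 * \<epsilon>"
      with le have "\<bar>q k - 1 / fact s\<bar> < 3 * \<epsilon>" by (rule le_less_trans)
      then show "dist (q k) (1 / fact s) < r" unfolding dist_real_def \<epsilon>_def by simp
    qed
  qed
  then show "(\<lambda>k. pmf (bind_pmf (G k) (induced_perm s)) \<sigma>)
      \<longlonglongrightarrow> pmf (pmf_of_set {\<tau>. \<tau> permutes {1..s}}) \<sigma>"
    unfolding q_def pmf_uniform_perm[OF \<sigma>] .
qed

end
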